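(* Let $d\in\mathbb{N}$, let $\mathfrak{L}^-$ be a finite set, and let $\mathcal{M}^{\mathrm{gen}}$ be the vector space spanned by all populated general multi-indices (over $\mathfrak{L}^-$ and $\mathbb{N}^{d+1}$), equipped with the products $\triangleright_{\mathbf{n}}$, $\mathbf{n}\in\mathbb{N}^{d+1}$, given by $z^{\beta}\triangleright_{\mathbf{n}}z^{\beta'}=z^{\beta}D^{(\mathbf{n})}(z^{\beta'})$. Then the $\mathbb{N}^{d+1}$-multi-Novikov algebra $\mathcal{M}^{\mathrm{gen}}$ is isomorphic to the free $\mathbb{N}^{d+1}$-multi-Novikov algebra generated by the set $\mathfrak{L}^-$.
   Context: Vector spaces are over a fixed field of characteristic zero. $\mathbb{N}=\{0,1,2,\dots\}$. For a set $A$, an $A$-multi-Novikov algebra is a vector space with bilinear products $x,y\mapsto x\triangleright_a y$, $a\in A$, satisfying for all $a,b\in A$ and all $x,y,z$: (1) $(x\triangleright_a y)\triangleright_b z-x\triangleright_a(y\triangleright_b z)=(y\triangleright_a x)\triangleright_b z-y\triangleright_a(x\triangleright_b z)$; (2) $(x\triangleright_a y)\triangleright_b z-x\triangleright_a(y\triangleright_b z)=(x\triangleright_b y)\triangleright_a z-x\triangleright_b(y\triangleright_a z)$; (3) $(x\triangleright_a y)\triangleright_b z=(x\triangleright_b z)\triangleright_a y$. Morphisms are linear maps commuting with all products; free algebras are meant in this category. For a set $I$, $M(I)$ is the set of finitely supported maps $w\colon I\to\mathbb{N}$; for $i\in I$, $e_i\in M(I)$ is the map with value $1$ at $i$ and $0$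 elsewhere. For $w\in M(\mathbb{N}^{d+1})$ put $\ell(w)=\sum_{\mathbf{n}\in\mathbb{N}^{d+1}}w(\mathbf{n})$. Introduce formal commuting variables $z_{(\mathfrak{l},w)}$, $(\mathfrak{l},w)\in\mathfrak{L}^-\times M(\mathbb{N}^{d+1})$. A general multi-index is a finitely supported map $\beta\colon\mathfrak{L}^-\times M(\mathbb{N}^{d+1})\to\mathbb{N}$, represented by the monomial $z^\beta=\prod_{(\mathfrak{l},w)}z_{(\mathfrak{l},w)}^{\beta(\mathfrak{l},w)}$ in the polynomial algebra in these variables. It is populated if $\sum_{(\mathfrak{l},w)}(1-\ell(w))\beta(\mathfrak{l},w)=1$. For $\mathbf{n}\in\mathbb{N}^{d+1}$, the derivation $D^{(\mathbf{n})}$ of the polynomial algebra is $D^{(\mathbf{n})}=\sum_{(\mathfrak{l},w)}(w(\mathbf{n})+1)\,z_{(\mathfrak{l},w+e_{\mathbf{n}})}\,\partial_{z_{(\mathfrak{l},w)}}$. The products $\triangleright_{\mathbf{n}}$ preserve $\mathcal{M}^{\mathrm{gen}}$ and make it an $\mathbb{N}^{d+1}$-multi-Novikov algebra. *)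

theory Defs
  imports
    "HOL-Library.Poly_Mapping"
    "HOL-Library.FuncSet"
    "HOL-Algebra.AbelCoset"
    "HOL-Algebra.Module"
    "HOL-Algebra.Algebraic_Closure_Type"
begin

section \<open>Multi-Novikov algebras\<close>

text \<open>The ground field is an arbitrary type of class \<^class>\<open>field_char_0\<close>, turned into a
  ring record by \<^const>\<open>ring_of_type_algebra\<close>, and vector spaces are the modules of
  \<^theory>\<open>HOL-Algebra.Module\<close> over it. The fields \<open>mult\<close> and \<open>one\<close> of a module record play no role
  in a module; they are left \<^const>\<open>undefined\<close> in the structures below.\<close>

record ('k, 'a, 'v) nov_algebra = "('k, 'v) module" +
  nprod :: "'v \<Rightarrow> 'a \<Rightarrow> 'v \<Rightarrow> 'v"  (\<open>(_ \<triangleright>[_]\<index> _)\<close> [71, 0, 71] 70)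

locale multi_novikov_algebra = module "ring_of_type_algebra :: 'k::field_char_0 ring" N
  for A :: "'a set" and N :: "('k::field_char_0, 'a, 'v, 'm) nov_algebra_scheme" (structure) +
  assumes nprod_closed:
      "a \<in> A \<Longrightarrow> x \<in> carrier N \<Longrightarrow> y \<in> carrier N \<Longrightarrow> x \<triangleright>[a] y \<in> carrier N"
    and nprod_add_left:
      "a \<in> A \<Longrightarrow> x \<in> carrier N \<Longrightarrow> y \<in> carrier N \<Longrightarrow> z \<in> carrier N \<Longrightarrow>
        (x \<oplus> y) \<triangleright>[a] z = (x \<triangleright>[a] z) \<oplus> (y \<triangleright>[a] z)"
    and nprod_add_right:
      "a \<in> A \<Longrightarrow> x \<in> carrier N \<Longrightarrow> y \<in> carrier N \<Longrightarrow> z \<in> carrier N \<Longrightarrow>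
        x \<triangleright>[a] (y \<oplus> z) = (x \<triangleright>[a] y) \<oplus> (x \<triangleright>[a] z)"
    and nprod_smult_left:
      "a \<in> A \<Longrightarrow> x \<in> carrier N \<Longrightarrow> y \<in> carrier N \<Longrightarrow>
        (c \<odot> x) \<triangleright>[a] y = c \<odot> (x \<triangleright>[a] y)"
    and nprod_smult_right:
      "a \<in> A \<Longrightarrow> x \<in> carrier N \<Longrightarrow> y \<in> carrier N \<Longrightarrow>
        x \<triangleright>[a] (c \<odot> y) = c \<odot> (x \<triangleright>[a] y)"
    and novikov1:
      "a \<in> A \<Longrightarrow> b \<in> A \<Longrightarrow> x \<in> carrier N \<Longrightarrow> y \<in> carrier N \<Longrightarrow> z \<in> carrier N \<Longrightarrow>
        ((x \<triangleright>[a] y) \<triangleright>[b] z) \<ominus> (x \<triangleright>[a] (y \<triangleright>[b] z))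
        = ((y \<triangleright>[a] x) \<triangleright>[b] z) \<ominus> (y \<triangleright>[a] (x \<triangleright>[b] z))"
    and novikov2:
      "a \<in> A \<Longrightarrow> b \<in> A \<Longrightarrow> x \<in> carrier N \<Longrightarrow> y \<in> carrier N \<Longrightarrow> z \<in> carrier N \<Longrightarrow>
        ((x \<triangleright>[a] y) \<triangleright>[b] z) \<ominus> (x \<triangleright>[a] (y \<triangleright>[b] z))
        = ((x \<triangleright>[b] y) \<triangleright>[a] z) \<ominus> (x \<triangleright>[b] (y \<triangleright>[a] z))"
    and novikov3:
      "a \<in> A \<Longrightarrow> b \<in> A \<Longrightarrow> x \<in> carrier N \<Longrightarrow> y \<in> carrier N \<Longrightarrow> z \<in> carrier N \<Longrightarrow>
        (x \<triangleright>[a] y) \<triangleright>[b] z = (x \<triangleright>[b] z) \<triangleright>[a] y"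

definition nov_hom ::
    "'a set \<Rightarrow> ('k, 'a, 'v, 'm) nov_algebra_scheme \<Rightarrow> ('k, 'a, 'w, 'n) nov_algebra_scheme
      \<Rightarrow> ('v \<Rightarrow> 'w) set"
  where "nov_hom A N N' = {h. h \<in> carrier N \<rightarrow> carrier N' \<and>
    (\<forall>x\<in>carrier N. \<forall>y\<in>carrier N. h (x \<oplus>\<^bsub>N\<^esub> y) = h x \<oplus>\<^bsub>N'\<^esub> h y) \<and>
    (\<forall>c. \<forall>x\<in>carrier N. h (c \<odot>\<^bsub>N\<^esub> x) = c \<odot>\<^bsub>N'\<^esub> h x) \<and>
    (\<forall>a\<in>A. \<forall>x\<in>carrier N. \<forall>y\<in>carrier N. h (x \<triangleright>[a]\<^bsub>N\<^esub> y) = h x \<triangleright>[a]\<^bsub>N'\<^esub> h y)}"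

definition nov_isomorphic ::
    "'a set \<Rightarrow> ('k::field_char_0, 'a, 'v, 'm) nov_algebra_scheme
      \<Rightarrow> ('k, 'a, 'w, 'n) nov_algebra_scheme \<Rightarrow> bool"
  where "nov_isomorphic A N N' \<longleftrightarrow>
    multi_novikov_algebra A N \<and> multi_novikov_algebra A N' \<and>
    (\<exists>h \<in> nov_hom A N N'. bij_betw h (carrier N) (carrier N'))"


section \<open>The free multi-Novikov algebra on a set\<close>

text \<open>The vector space with basis \<open>B\<close>: finitely supported families of scalars indexed by \<open>B\<close>.\<close>

definition lin_combs :: "'b set \<Rightarrow> ('b \<Rightarrow>\<^sub>0 'k::zero) set"
  where "lin_combs B = {p. Poly_Mapping.keys p \<subseteq> B}"

definition pm_smult :: "'k::semiring_0 \<Rightarrow> ('b \<Rightarrow>\<^sub>0 'k) \<Rightarrow> ('b \<Rightarrow>\<^sub>0 'k)"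
  where "pm_smult c p = Poly_Mapping.map ((*) c) p"

text \<open>Formal products of generators: binary trees with leaves decorated by generators and inner
  vertices decorated by the labels of the products.\<close>

datatype (labels: 'a, gens: 'l) nov_term =
  Gen 'l | Prod "('a, 'l) nov_term" 'a "('a, 'l) nov_term"

definition nov_terms :: "'a set \<Rightarrow> 'l set \<Rightarrow> ('a, 'l) nov_term set"
  where "nov_terms A L = {t. labels t \<subseteq> A \<and> gens t \<subseteq> L}"

definition magma_prod ::
    "(('a, 'l) nov_term \<Rightarrow>\<^sub>0 'k::semiring_0) \<Rightarrow> 'a \<Rightarrow> (('a, 'l) nov_term \<Rightarrow>\<^sub>0 'k)
      \<Rightarrow> (('a, 'l) nov_term \<Rightarrow>\<^sub>0 'k)"
  where "magma_prod p a q = (\<Sum>s\<in>Poly_Mapping.keys p. \<Sum>t\<in>Poly_Mapping.keys q.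
    Poly_Mapping.single (Prod s a t) (Poly_Mapping.lookup p s * Poly_Mapping.lookup q t))"

text \<open>The free vector space with an \<open>A\<close>-indexed family of bilinear products (no relations).\<close>

definition free_magmatic ::
    "'a set \<Rightarrow> 'l set \<Rightarrow> ('k::field_char_0, 'a, ('a, 'l) nov_term \<Rightarrow>\<^sub>0 'k) nov_algebra"
  where "free_magmatic A L =
    \<lparr>carrier = lin_combs (nov_terms A L), monoid.mult = undefined, one = undefined,
     zero = 0, add = (+), module.smult = pm_smult, nprod = magma_prod\<rparr>"

text \<open>The ideal generated by the three multi-Novikov identities.\<close>

inductive_set nov_ideal ::
    "'a set \<Rightarrow> 'l set \<Rightarrow> (('a, 'l) nov_term \<Rightarrow>\<^sub>0 'k::field_char_0) set"
  for A :: "'a set" and L :: "'l set"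
  where
    zero: "0 \<in> nov_ideal A L"
  | add: "p \<in> nov_ideal A L \<Longrightarrow> q \<in> nov_ideal A L \<Longrightarrow> p + q \<in> nov_ideal A L"
  | smult: "p \<in> nov_ideal A L \<Longrightarrow> pm_smult c p \<in> nov_ideal A L"
  | prod_left: "a \<in> A \<Longrightarrow> p \<in> nov_ideal A L \<Longrightarrow> x \<in> lin_combs (nov_terms A L) \<Longrightarrow>
      magma_prod x a p \<in> nov_ideal A L"
  | prod_right: "a \<in> A \<Longrightarrow> p \<in> nov_ideal A L \<Longrightarrow> x \<in> lin_combs (nov_terms A L) \<Longrightarrow>
      magma_prod p a x \<in> nov_ideal A L"
  | rel1: "a \<in> A \<Longrightarrow> b \<in> A \<Longrightarrow> x \<in> lin_combs (nov_terms A L) \<Longrightarrow>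
      y \<in> lin_combs (nov_terms A L) \<Longrightarrow> z \<in> lin_combs (nov_terms A L) \<Longrightarrow>
      (magma_prod (magma_prod x a y) b z - magma_prod x a (magma_prod y b z))
      - (magma_prod (magma_prod y a x) b z - magma_prod y a (magma_prod x b z)) \<in> nov_ideal A L"
  | rel2: "a \<in> A \<Longrightarrow> b \<in> A \<Longrightarrow> x \<in> lin_combs (nov_terms A L) \<Longrightarrow>
      y \<in> lin_combs (nov_terms A L) \<Longrightarrow> z \<in> lin_combs (nov_terms A L) \<Longrightarrow>
      (magma_prod (magma_prod x a y) b z - magma_prod x a (magma_prod y b z))
      - (magma_prod (magma_prod x b y) a z - magma_prod x b (magma_prod y a z)) \<in> nov_ideal A L"
  | rel3: "a \<in> A \<Longrightarrow> b \<in> A \<Longrightarrow> x \<in> lin_combs (nov_terms A L) \<Longrightarrow>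
      y \<in> lin_combs (nov_terms A L) \<Longrightarrow> z \<in> lin_combs (nov_terms A L) \<Longrightarrow>
      magma_prod (magma_prod x a y) b z - magma_prod (magma_prod x b z) a y \<in> nov_ideal A L"

text \<open>The free multi-Novikov algebra is the quotient of the free magmatic algebra by this ideal;
  the operations on cosets are written in the style of \<open>rcoset_mult\<close> and \<open>FactRing\<close> of
  \<open>HOL-Algebra.QuotRing\<close>. Its universal property is \<open>free_multi_novikov_universal\<close> below.\<close>

definition free_multi_novikov ::
    "'a set \<Rightarrow> 'l set \<Rightarrow> ('k::field_char_0, 'a, (('a, 'l) nov_term \<Rightarrow>\<^sub>0 'k) set) nov_algebra"
  where "free_multi_novikov A L = (let T = free_magmatic A L; J = nov_ideal A L in
    \<lparr>carrier = a_rcosets\<^bsub>T\<^esub> J, monoid.mult = undefined, one = undefined,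
     zero = J, add = set_add T,
     module.smult = (\<lambda>c U. \<Union>x\<in>U. J +>\<^bsub>T\<^esub> (c \<odot>\<^bsub>T\<^esub> x)),
     nprod = (\<lambda>U a V. \<Union>x\<in>U. \<Union>y\<in>V. J +>\<^bsub>T\<^esub> (x \<triangleright>[a]\<^bsub>T\<^esub> y))\<rparr>)"

definition free_gen ::
    "'a set \<Rightarrow> 'l set \<Rightarrow> 'l \<Rightarrow> (('a, 'l) nov_term \<Rightarrow>\<^sub>0 'k::field_char_0) set"
  where "free_gen A L l = nov_ideal A L +>\<^bsub>free_magmatic A L\<^esub> Poly_Mapping.single (Gen l) 1"


section \<open>Multi-indices\<close>

text \<open>\<open>\<nat>\<^sup>d\<^sup>+\<^sup>1\<close>, as the functions on \<open>{0, \<dots>, d}\<close>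
  (extended by \<^const>\<open>undefined\<close> outside this set).\<close>

definition Nd :: "nat \<Rightarrow> (nat \<Rightarrow> nat) set"
  where "Nd d = ({..d} \<rightarrow>\<^sub>E UNIV)"

text \<open>Finitely supported maps \<open>I \<rightarrow> \<nat>\<close>, extended by zero outside \<open>I\<close>.\<close>

definition fin_maps :: "'i set \<Rightarrow> ('i \<Rightarrow>\<^sub>0 nat) set"
  where "fin_maps I = {w. Poly_Mapping.keys w \<subseteq> I}"

definition len :: "('i \<Rightarrow>\<^sub>0 nat) \<Rightarrow> nat"
  where "len w = (\<Sum>n\<in>Poly_Mapping.keys w. Poly_Mapping.lookup w n)"

type_synonym ('a, 'l) zvar = "'l \<times> ('a \<Rightarrow>\<^sub>0 nat)"
type_synonym ('a, 'l) multi_index = "('a, 'l) zvar \<Rightarrow>\<^sub>0 nat"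
type_synonym ('a, 'l, 'k) zpoly = "('a, 'l) multi_index \<Rightarrow>\<^sub>0 'k"

definition gen_multi_indices :: "'a set \<Rightarrow> 'l set \<Rightarrow> ('a, 'l) multi_index set"
  where "gen_multi_indices A L = fin_maps (L \<times> fin_maps A)"

definition populated :: "('a, 'l) multi_index \<Rightarrow> bool"
  where "populated \<beta> \<longleftrightarrow> (\<Sum>(l, w)\<in>Poly_Mapping.keys \<beta>.
    (1 - int (len w)) * int (Poly_Mapping.lookup \<beta> (l, w))) = 1"

text \<open>The polynomial algebra is the monoid algebra of multi-indices: addition and multiplication
  are those of \<open>\<Rightarrow>\<^sub>0\<close>, and \<open>z\<^sup>\<beta>\<close> is \<open>Poly_Mapping.single \<beta> 1\<close>.\<close>

definition zvar :: "('a, 'l) zvar \<Rightarrow> ('a, 'l, 'k::field_char_0) zpoly"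
  where "zvar v = Poly_Mapping.single (Poly_Mapping.single v 1) 1"

definition zpartial ::
    "('a, 'l) zvar \<Rightarrow> ('a, 'l, 'k::field_char_0) zpoly \<Rightarrow> ('a, 'l, 'k) zpoly"
  where "zpartial v P = (\<Sum>\<beta>\<in>Poly_Mapping.keys P.
    Poly_Mapping.single (\<beta> - Poly_Mapping.single v 1)
      (of_nat (Poly_Mapping.lookup \<beta> v) * Poly_Mapping.lookup P \<beta>))"

text \<open>\<open>Sum_any\<close> sums over all pairs \<open>(l, w)\<close> of the given types; only the finitely many variables
  occurring in \<open>P\<close> contribute.\<close>

definition zD :: "'a \<Rightarrow> ('a, 'l, 'k::field_char_0) zpoly \<Rightarrow> ('a, 'l, 'k) zpoly"
  where "zD n P = Sum_any (\<lambda>(l, w). of_nat (Poly_Mapping.lookup w n + 1)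
    * zvar (l, w + Poly_Mapping.single n 1) * zpartial (l, w) P)"

definition M_gen ::
    "nat \<Rightarrow> 'l set \<Rightarrow> ('k::field_char_0, nat \<Rightarrow> nat, (nat \<Rightarrow> nat, 'l, 'k) zpoly) nov_algebra"
  where "M_gen d L =
    \<lparr>carrier = lin_combs {\<beta> \<in> gen_multi_indices (Nd d) L. populated \<beta>},
     monoid.mult = undefined, one = undefined, zero = 0, add = (+), module.smult = pm_smult,
     nprod = (\<lambda>P n Q. P * zD n Q)\<rparr>"

section \<open>The universal property of the free multi-Novikov algebra\<close>

lemma carrier_ring_of_type [simp]: "carrier (ring_of_type_algebra :: 'k::field_char_0 ring) = UNIV"
  and zero_ring_of_type [simp]: "\<zero>\<^bsub>(ring_of_type_algebra :: 'k ring)\<^esub> = 0"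
  and one_ring_of_type [simp]: "\<one>\<^bsub>(ring_of_type_algebra :: 'k ring)\<^esub> = 1"
  and add_ring_of_type [simp]: "x \<oplus>\<^bsub>(ring_of_type_algebra :: 'k ring)\<^esub> y = x + y"
  and mult_ring_of_type [simp]: "x \<otimes>\<^bsub>(ring_of_type_algebra :: 'k ring)\<^esub> y = x * y"
  by (simp_all add: ring_of_type_algebra_def)

lemma lookup_pm_smult [simp]: "Poly_Mapping.lookup (pm_smult c p) t = c * Poly_Mapping.lookup p t"
  by (simp add: pm_smult_def Poly_Mapping.map.rep_eq when_def)

lemma keys_pm_smult: "Poly_Mapping.keys (pm_smult c p) \<subseteq> Poly_Mapping.keys p"
  by (auto simp: in_keys_iff)

lemma lin_combs_zero [simp]: "0 \<in> lin_combs B"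
  by (simp add: lin_combs_def)

lemma lin_combs_add: "p \<in> lin_combs B \<Longrightarrow> q \<in> lin_combs B \<Longrightarrow> p + q \<in> lin_combs B"
  using Poly_Mapping.keys_add[of p q] by (auto simp: lin_combs_def)

lemma lin_combs_smult: "p \<in> lin_combs B \<Longrightarrow> pm_smult c p \<in> lin_combs B"
  using keys_pm_smult[of c p] by (auto simp: lin_combs_def)

lemma lin_combs_uminus: "(p :: 'b \<Rightarrow>\<^sub>0 'k::ab_group_add) \<in> lin_combs B \<Longrightarrow> - p \<in> lin_combs B"
  by (auto simp: lin_combs_def in_keys_iff)

lemma lin_combs_diff:
  "(p :: 'b \<Rightarrow>\<^sub>0 'k::ab_group_add) \<in> lin_combs B \<Longrightarrow> q \<in> lin_combs B \<Longrightarrow> p - q \<in> lin_combs B"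
  using lin_combs_add[of p B "- q"] lin_combs_uminus[of q B] by simp

lemma lin_combs_single: "t \<in> B \<Longrightarrow> Poly_Mapping.single t c \<in> lin_combs B"
  by (simp add: lin_combs_def)

lemma lin_combs_sum: "(\<And>i. i \<in> I \<Longrightarrow> p i \<in> lin_combs B) \<Longrightarrow> sum p I \<in> lin_combs B"
  by (induction I rule: infinite_finite_induct) (auto intro: lin_combs_add)

lemma pm_smult_minus_one: "pm_smult (-1) p = - (p :: 'b \<Rightarrow>\<^sub>0 'k::ring_1)"
  by (rule poly_mapping_eqI) simp

lemma pm_smult_simps:
  fixes p q :: "'b \<Rightarrow>\<^sub>0 'k::comm_ring_1"
  shows "pm_smult c (p + q) = pm_smult c p + pm_smult c q"
    and "pm_smult (c + d) p = pm_smult c p + pm_smult d p"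
    and "pm_smult (c * d) p = pm_smult c (pm_smult d p)"
    and "pm_smult 1 p = p"
    and "pm_smult c (p - q) = pm_smult c p - pm_smult c q"
    and "pm_smult c (Poly_Mapping.single t d) = Poly_Mapping.single t (c * d)"
    and "pm_smult c (0 :: 'b \<Rightarrow>\<^sub>0 'k) = 0"
  by (rule poly_mapping_eqI, simp add: lookup_add lookup_minus lookup_single when_def algebra_simps)+

lemma lin_combs_induct [consumes 1, case_names zero single add]:
  assumes "p \<in> lin_combs B"
    and "P 0" and "\<And>t c. t \<in> B \<Longrightarrow> P (Poly_Mapping.single t c)"
    and "\<And>p q. p \<in> lin_combs B \<Longrightarrow> q \<in> lin_combs B \<Longrightarrow> P p \<Longrightarrow> P q \<Longrightarrow> P (p + q)"
  shows "P (p :: 'b \<Rightarrow>\<^sub>0 'k::ab_group_add)"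
proof -
  have fin: "finite (Poly_Mapping.keys p)" by simp
  have sub: "Poly_Mapping.keys p \<subseteq> B" using assms(1) by (simp add: lin_combs_def)
  have step: "P (\<Sum>t\<in>S. Poly_Mapping.single t (Poly_Mapping.lookup p t))"
    if "finite S" "S \<subseteq> B" for S
    using that
  proof (induction S rule: finite_induct)
    case (insert t S)
    have "(\<Sum>t\<in>S. Poly_Mapping.single t (Poly_Mapping.lookup p t)) \<in> lin_combs B"
      using insert.prems by (intro lin_combs_sum lin_combs_single) auto
    then show ?case using insert by (auto intro!: assms(3,4) lin_combs_single)
  qed (simp add: assms(2))
  have "p = (\<Sum>t\<in>Poly_Mapping.keys p. Poly_Mapping.single t (Poly_Mapping.lookup p t))"
    by (rule poly_mapping_eqI)
      (auto simp: lookup_sum lookup_single when_def in_keys_iff)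
  then show ?thesis using step[OF fin sub] by simp
qed

lemma magma_prod_superset:
  assumes "finite S" "Poly_Mapping.keys p \<subseteq> S" "finite T" "Poly_Mapping.keys q \<subseteq> T"
  shows "magma_prod p a q = (\<Sum>s\<in>S. \<Sum>t\<in>T.
    Poly_Mapping.single (Prod s a t) (Poly_Mapping.lookup p s * Poly_Mapping.lookup q t))"
proof -
  have "magma_prod p a q = (\<Sum>s\<in>Poly_Mapping.keys p. \<Sum>t\<in>T.
      Poly_Mapping.single (Prod s a t) (Poly_Mapping.lookup p s * Poly_Mapping.lookup q t))"
    unfolding magma_prod_def
    by (intro sum.cong refl sum.mono_neutral_left) (auto simp: assms in_keys_iff)
  also have "\<dots> = (\<Sum>s\<in>S. \<Sum>t\<in>T.
      Poly_Mapping.single (Prod s a t) (Poly_Mapping.lookup p s * Poly_Mapping.lookup q t))"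
    by (intro sum.mono_neutral_left) (auto simp: assms in_keys_iff)
  finally show ?thesis .
qed

lemma magma_prod_single:
  "magma_prod (Poly_Mapping.single s c) a (Poly_Mapping.single t d)
    = Poly_Mapping.single (Prod s a t) (c * d)"
  by (subst magma_prod_superset[of "{s}" _ "{t}"]) auto

lemma magma_prod_add_left: "magma_prod (p + p') a q = magma_prod p a q + magma_prod p' a q"
proof -
  let ?S = "Poly_Mapping.keys p \<union> Poly_Mapping.keys p'" and ?T = "Poly_Mapping.keys q"
  show ?thesis
    by (subst (1 2 3) magma_prod_superset[of ?S _ ?T])
      (use Poly_Mapping.keys_add[of p p'] in
        \<open>auto simp: lookup_add distrib_right single_add sum.distrib\<close>)
qed

lemma magma_prod_add_right: "magma_prod q a (p + p') = magma_prod q a p + magma_prod q a p'"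
proof -
  let ?S = "Poly_Mapping.keys p \<union> Poly_Mapping.keys p'" and ?T = "Poly_Mapping.keys q"
  show ?thesis
    by (subst (1 2 3) magma_prod_superset[of ?T _ ?S])
      (use Poly_Mapping.keys_add[of p p'] in
        \<open>auto simp: lookup_add distrib_left single_add sum.distrib\<close>)
qed

lemma pm_smult_sum: "pm_smult c (sum p I) = (\<Sum>i\<in>I. pm_smult c (p i :: 'b \<Rightarrow>\<^sub>0 'k::comm_ring_1))"
  by (induction I rule: infinite_finite_induct) (simp_all add: pm_smult_simps)

lemma magma_prod_smult_left:
  "magma_prod (pm_smult c p) a q = pm_smult c (magma_prod p a (q :: _ \<Rightarrow>\<^sub>0 'k::comm_ring_1))"
proof -
  let ?S = "Poly_Mapping.keys p" and ?T = "Poly_Mapping.keys q"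
  show ?thesis
    by (subst (1 2) magma_prod_superset[of ?S _ ?T])
      (auto simp: keys_pm_smult pm_smult_sum pm_smult_simps mult.assoc)
qed

lemma magma_prod_smult_right:
  "magma_prod p a (pm_smult c q) = pm_smult c (magma_prod p a (q :: _ \<Rightarrow>\<^sub>0 'k::comm_ring_1))"
proof -
  let ?S = "Poly_Mapping.keys p" and ?T = "Poly_Mapping.keys q"
  show ?thesis
    by (subst (1 2) magma_prod_superset[of ?S _ ?T])
      (auto simp: keys_pm_smult pm_smult_sum pm_smult_simps mult.left_commute)
qed

lemma magma_prod_diff:
  fixes q :: "('a, 'l) nov_term \<Rightarrow>\<^sub>0 'k::comm_ring_1"
  shows "magma_prod (p - p') a q = magma_prod p a q - magma_prod p' a q"
    and "magma_prod q a (p - p') = magma_prod q a p - magma_prod q a p'"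
  using magma_prod_add_left[of "p - p'" p' a q] magma_prod_add_right[of q a "p - p'" p']
  by (simp_all add: algebra_simps)

lemma magma_prod_closed:
  assumes "a \<in> A" "p \<in> lin_combs (nov_terms A L)" "q \<in> lin_combs (nov_terms A L)"
  shows "magma_prod p a q \<in> lin_combs (nov_terms A L)"
  unfolding magma_prod_def using assms
  by (intro lin_combs_sum lin_combs_single) (auto simp: lin_combs_def nov_terms_def)

lemma nov_ideal_subset: "p \<in> nov_ideal A L \<Longrightarrow> p \<in> lin_combs (nov_terms A L)"
  by (induction rule: nov_ideal.induct)
    (auto intro: lin_combs_add lin_combs_smult lin_combs_diff magma_prod_closed)

lemma nov_ideal_uminus: "p \<in> nov_ideal A L \<Longrightarrow> - p \<in> nov_ideal A L"
  using nov_ideal.smult[of p A L "-1"] by (simp add: pm_smult_minus_one)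

lemma nov_ideal_diff: "p \<in> nov_ideal A L \<Longrightarrow> q \<in> nov_ideal A L \<Longrightarrow> p - q \<in> nov_ideal A L"
  using nov_ideal.add[of p A L "- q"] nov_ideal_uminus[of q A L] by simp

definition nov_coset ::
    "'a set \<Rightarrow> 'l set \<Rightarrow> (('a, 'l) nov_term \<Rightarrow>\<^sub>0 'k::field_char_0) \<Rightarrow> (('a, 'l) nov_term \<Rightarrow>\<^sub>0 'k) set"
  where "nov_coset A L x = nov_ideal A L +>\<^bsub>free_magmatic A L\<^esub> x"

lemma mem_nov_coset: "y \<in> nov_coset A L x \<longleftrightarrow> y - x \<in> nov_ideal A L"
  by (force simp: nov_coset_def a_r_coset_def' free_magmatic_def)

lemma nov_coset_eq_iff: "nov_coset A L x = nov_coset A L y \<longleftrightarrow> x - y \<in> nov_ideal A L"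
proof
  assume "nov_coset A L x = nov_coset A L y"
  moreover have "x \<in> nov_coset A L x" by (simp add: mem_nov_coset nov_ideal.zero)
  ultimately show "x - y \<in> nov_ideal A L" by (simp add: mem_nov_coset)
next
  assume xy: "x - y \<in> nov_ideal A L"
  have "z - x \<in> nov_ideal A L \<longleftrightarrow> z - y \<in> nov_ideal A L" for z
    using nov_ideal.add[OF _ xy, of "z - x"] nov_ideal_diff[OF _ xy, of "z - y"] by auto
  then show "nov_coset A L x = nov_coset A L y" by (auto simp: mem_nov_coset)
qed

lemma nov_coset_const:
  assumes "x \<in> U" "\<And>y. y \<in> U \<Longrightarrow> F y = Z"
  shows "(\<Union>y\<in>U. F y) = Z"
  using assms by auto

lemma free_carrier:
  "carrier (free_multi_novikov A L) = nov_coset A L ` lin_combs (nov_terms A L)"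
  by (auto simp: free_multi_novikov_def Let_def A_RCOSETS_def RCOSETS_def nov_coset_def
      a_r_coset_def free_magmatic_def)

lemma free_zero: "\<zero>\<^bsub>free_multi_novikov A L\<^esub> = nov_coset A L 0"
  by (auto simp: mem_nov_coset free_multi_novikov_def Let_def)

lemma free_add:
  "nov_coset A L x \<oplus>\<^bsub>free_multi_novikov A L\<^esub> nov_coset A L y = nov_coset A L (x + y)"
proof -
  have eq: "nov_coset A L x \<oplus>\<^bsub>free_multi_novikov A L\<^esub> nov_coset A L y
      = {u + v | u v. u \<in> nov_coset A L x \<and> v \<in> nov_coset A L y}"
    by (auto simp: free_multi_novikov_def Let_def set_add_def set_mult_def free_magmatic_def)
  show ?thesis
  proof (rule Set.set_eqI)
    fix z
    show "z \<in> nov_coset A L x \<oplus>\<^bsub>free_multi_novikov A L\<^esub> nov_coset A L y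
        \<longleftrightarrow> z \<in> nov_coset A L (x + y)"
    proof
      assume "z \<in> nov_coset A L x \<oplus>\<^bsub>free_multi_novikov A L\<^esub> nov_coset A L y"
      then obtain u v where "z = u + v" "u - x \<in> nov_ideal A L" "v - y \<in> nov_ideal A L"
        by (auto simp: eq mem_nov_coset)
      then show "z \<in> nov_coset A L (x + y)"
        using nov_ideal.add[of "u - x" A L "v - y"] by (simp add: mem_nov_coset algebra_simps)
    next
      assume "z \<in> nov_coset A L (x + y)"
      then have "z = (z - y) + y" "z - y \<in> nov_coset A L x" "y \<in> nov_coset A L y"
        by (auto simp: mem_nov_coset algebra_simps nov_ideal.zero)
      then show "z \<in> nov_coset A L x \<oplus>\<^bsub>free_multi_novikov A L\<^esub> nov_coset A L y"
        unfolding eq by blast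
    qed
  qed
qed

lemma free_smult:
  "c \<odot>\<^bsub>free_multi_novikov A L\<^esub> nov_coset A L x = nov_coset A L (pm_smult c x)"
proof -
  have "c \<odot>\<^bsub>free_multi_novikov A L\<^esub> nov_coset A L x
      = (\<Union>y\<in>nov_coset A L x. nov_coset A L (pm_smult c y))"
    by (simp add: free_multi_novikov_def Let_def nov_coset_def) (simp add: free_magmatic_def)
  also have "\<dots> = nov_coset A L (pm_smult c x)"
  proof (rule nov_coset_const[of x])
    show "x \<in> nov_coset A L x" by (simp add: mem_nov_coset nov_ideal.zero)
    fix y assume "y \<in> nov_coset A L x"
    then have "pm_smult c (y - x) \<in> nov_ideal A L"
      by (auto simp: mem_nov_coset intro: nov_ideal.smult)
    then show "nov_coset A L (pm_smult c y) = nov_coset A L (pm_smult c x)"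
      by (simp add: nov_coset_eq_iff pm_smult_simps)
  qed
  finally show ?thesis .
qed

lemma free_nprod:
  assumes "a \<in> A" "x \<in> lin_combs (nov_terms A L)" "y \<in> lin_combs (nov_terms A L)"
  shows "nov_coset A L x \<triangleright>[a]\<^bsub>free_multi_novikov A L\<^esub> nov_coset A L y
    = nov_coset A L (magma_prod x a y)"
proof -
  have "nov_coset A L x \<triangleright>[a]\<^bsub>free_multi_novikov A L\<^esub> nov_coset A L y
      = (\<Union>u\<in>nov_coset A L x. \<Union>v\<in>nov_coset A L y. nov_coset A L (magma_prod u a v))"
    by (simp add: free_multi_novikov_def Let_def nov_coset_def) (simp add: free_magmatic_def)
  also have "\<dots> = nov_coset A L (magma_prod x a y)"
  proof (rule nov_coset_const[of x], simp add: mem_nov_coset nov_ideal.zero,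
      rule nov_coset_const[of y], simp add: mem_nov_coset nov_ideal.zero)
    fix u v assume "u \<in> nov_coset A L x" "v \<in> nov_coset A L y"
    then have uv: "u - x \<in> nov_ideal A L" "v - y \<in> nov_ideal A L"
      by (auto simp: mem_nov_coset)
    have "u = (u - x) + x" by simp
    then have "u \<in> lin_combs (nov_terms A L)"
      using lin_combs_add[OF nov_ideal_subset[OF uv(1)] assms(2)] by simp
    then have "magma_prod u a (v - y) + magma_prod (u - x) a y \<in> nov_ideal A L"
      using uv assms by (intro nov_ideal.add nov_ideal.prod_left nov_ideal.prod_right)
    then show "nov_coset A L (magma_prod u a v) = nov_coset A L (magma_prod x a y)"
      by (simp add: nov_coset_eq_iff magma_prod_diff)
  qed
  finally show ?thesis .
qed

lemma free_abelian_group: "abelian_group (free_multi_novikov A L)"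
proof (rule abelian_groupI)
  fix U assume "U \<in> carrier (free_multi_novikov A L)"
  then obtain x where x: "x \<in> lin_combs (nov_terms A L)" "U = nov_coset A L x"
    by (auto simp: free_carrier)
  then show "\<exists>V\<in>carrier (free_multi_novikov A L).
      V \<oplus>\<^bsub>free_multi_novikov A L\<^esub> U = \<zero>\<^bsub>free_multi_novikov A L\<^esub>"
    by (auto simp: free_carrier free_zero free_add lin_combs_uminus
        intro!: bexI[of _ "- x"])
qed (auto simp: free_carrier free_zero free_add lin_combs_add algebra_simps)

lemma free_module:
  "Module.module (ring_of_type_algebra :: 'k::field_char_0 ring)
    (free_multi_novikov A L :: ('k, 'a, (('a, 'l) nov_term \<Rightarrow>\<^sub>0 'k) set) nov_algebra)"
  by (rule moduleI)
    (auto simp: cring_from_type_algebra free_abelian_group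
      free_carrier free_add free_smult lin_combs_smult pm_smult_simps)

lemma free_minus:
  fixes x y :: "('a, 'l) nov_term \<Rightarrow>\<^sub>0 'k::field_char_0"
  assumes "x \<in> lin_combs (nov_terms A L)" "y \<in> lin_combs (nov_terms A L)"
  shows "nov_coset A L x \<ominus>\<^bsub>free_multi_novikov A L\<^esub> nov_coset A L y = nov_coset A L (x - y)"
proof -
  interpret F: abelian_group "free_multi_novikov A L :: ('k, 'a, (('a, 'l) nov_term \<Rightarrow>\<^sub>0 'k) set) nov_algebra"
    by (rule free_abelian_group)
  have "\<ominus>\<^bsub>free_multi_novikov A L\<^esub> nov_coset A L y = nov_coset A L (- y)"
    by (rule F.minus_equality)
      (use assms in \<open>auto simp: free_add free_zero free_carrier lin_combs_uminus\<close>)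
  then show ?thesis by (simp add: a_minus_def free_add)
qed

theorem free_multi_novikov_algebra:
  "multi_novikov_algebra A
    (free_multi_novikov A L :: ('k::field_char_0, 'a, (('a, 'l) nov_term \<Rightarrow>\<^sub>0 'k) set) nov_algebra)"
proof (intro multi_novikov_algebra.intro free_module multi_novikov_algebra_axioms.intro)
qed (auto simp: free_carrier free_add free_smult free_nprod free_minus magma_prod_closed
    lin_combs_add lin_combs_smult magma_prod_add_left magma_prod_add_right magma_prod_smult_left
    magma_prod_smult_right nov_coset_eq_iff
    intro!: imageI nov_ideal.zero nov_ideal.rel1 nov_ideal.rel2 nov_ideal.rel3 del: equalityI)

lemma free_gen_closed: "l \<in> L \<Longrightarrow> free_gen A L l \<in> carrier (free_multi_novikov A L)"
  by (auto simp: free_carrier free_gen_def nov_coset_def[symmetric] nov_terms_def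
      intro!: imageI lin_combs_single)

context multi_novikov_algebra
begin

primrec nov_eval :: "('l \<Rightarrow> 'v) \<Rightarrow> ('a, 'l) nov_term \<Rightarrow> 'v" where
  "nov_eval f (Gen l) = f l"
| "nov_eval f (Prod s a t) = nov_eval f s \<triangleright>[a] nov_eval f t"

definition nov_ext :: "('l \<Rightarrow> 'v) \<Rightarrow> (('a, 'l) nov_term \<Rightarrow>\<^sub>0 'k) \<Rightarrow> 'v" where
  "nov_ext f p = (\<Oplus>t\<in>Poly_Mapping.keys p. Poly_Mapping.lookup p t \<odot> nov_eval f t)"

lemma smult_in [simp]: "x \<in> carrier N \<Longrightarrow> c \<odot> x \<in> carrier N"
  using smult_closed by simp

lemma smult_zero_left [simp]: "x \<in> carrier N \<Longrightarrow> 0 \<odot> x = \<zero>"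
  using smult_l_null by simp

lemma smult_zero_right [simp]: "c \<odot> \<zero> = \<zero>"
  using smult_r_null[of c] by simp

lemma nprod_zero:
  assumes "a \<in> A" "x \<in> carrier N"
  shows "\<zero> \<triangleright>[a] x = \<zero>" "x \<triangleright>[a] \<zero> = \<zero>"
  using nprod_smult_left[OF assms(1) M.zero_closed assms(2), of 0]
    nprod_smult_right[OF assms M.zero_closed, of 0]
    nprod_closed[OF assms(1) M.zero_closed assms(2)] nprod_closed[OF assms M.zero_closed]
  by simp_all

lemma minus_eq_smult: "x \<in> carrier N \<Longrightarrow> \<ominus> x = (-1) \<odot> x"
proof -
  assume x: "x \<in> carrier N"
  have "(-1 + 1) \<odot> x = (-1) \<odot> x \<oplus> 1 \<odot> x"
    using smult_l_distr[of "-1" 1 x] x by simp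
  then have "(-1) \<odot> x \<oplus> x = \<zero>"
    using smult_one[of x] x by simp
  then show ?thesis by (intro M.minus_equality) (use x in auto)
qed

context
  fixes f :: "'l \<Rightarrow> 'v" and L :: "'l set"
  assumes f: "f \<in> L \<rightarrow> carrier N"
begin

lemma nov_eval_closed: "t \<in> nov_terms A L \<Longrightarrow> nov_eval f t \<in> carrier N"
  by (induction t) (use f in \<open>auto simp: nov_terms_def intro: nprod_closed\<close>)

lemma nov_ext_superset:
  assumes "finite S" "Poly_Mapping.keys p \<subseteq> S" "S \<subseteq> nov_terms A L"
  shows "nov_ext f p = (\<Oplus>t\<in>S. Poly_Mapping.lookup p t \<odot> nov_eval f t)"
  unfolding nov_ext_def using assms
  by (intro M.add.finprod_mono_neutral_cong_left)
    (auto simp: in_keys_iff intro!: smult_in nov_eval_closed smult_zero_left)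

lemma nov_ext_closed: "p \<in> lin_combs (nov_terms A L) \<Longrightarrow> nov_ext f p \<in> carrier N"
  unfolding nov_ext_def lin_combs_def
  by (intro M.finsum_closed) (auto intro!: smult_in nov_eval_closed)

lemma nov_ext_zero [simp]: "nov_ext f 0 = \<zero>"
  by (simp add: nov_ext_def)

lemma nov_ext_add:
  assumes "p \<in> lin_combs (nov_terms A L)" "q \<in> lin_combs (nov_terms A L)"
  shows "nov_ext f (p + q) = nov_ext f p \<oplus> nov_ext f q"
proof -
  let ?S = "Poly_Mapping.keys p \<union> Poly_Mapping.keys q"
  have S: "finite ?S" "?S \<subseteq> nov_terms A L" using assms by (auto simp: lin_combs_def)
  have "nov_ext f (p + q)
      = (\<Oplus>t\<in>?S. Poly_Mapping.lookup (p + q) t \<odot> nov_eval f t)"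
    by (rule nov_ext_superset) (use S Poly_Mapping.keys_add[of p q] in auto)
  also have "\<dots> = (\<Oplus>t\<in>?S. Poly_Mapping.lookup p t \<odot> nov_eval f t
      \<oplus> Poly_Mapping.lookup q t \<odot> nov_eval f t)"
  proof (rule M.finsum_cong')
    fix t assume "t \<in> ?S"
    then have "nov_eval f t \<in> carrier N" using S nov_eval_closed by blast
    then show "Poly_Mapping.lookup (p + q) t \<odot> nov_eval f t
        = Poly_Mapping.lookup p t \<odot> nov_eval f t \<oplus> Poly_Mapping.lookup q t \<odot> nov_eval f t"
      using smult_l_distr[of "Poly_Mapping.lookup p t" "Poly_Mapping.lookup q t" "nov_eval f t"]
      by (simp add: lookup_add)
  qed (use S nov_eval_closed in auto)
  also have "\<dots> = (\<Oplus>t\<in>?S. Poly_Mapping.lookup p t \<odot> nov_eval f t)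
      \<oplus> (\<Oplus>t\<in>?S. Poly_Mapping.lookup q t \<odot> nov_eval f t)"
    by (rule M.finsum_addf) (use S nov_eval_closed in auto)
  also have "\<dots> = nov_ext f p \<oplus> nov_ext f q"
    using S by (subst (1 2) nov_ext_superset[of ?S]) auto
  finally show ?thesis .
qed

lemma nov_ext_single:
  assumes "t \<in> nov_terms A L"
  shows "nov_ext f (Poly_Mapping.single t c) = c \<odot> nov_eval f t"
  using assms by (subst nov_ext_superset[of "{t}"]) (auto simp: nov_eval_closed)

lemma nov_ext_smult:
  assumes "p \<in> lin_combs (nov_terms A L)"
  shows "nov_ext f (pm_smult c p) = c \<odot> nov_ext f p"
  using assms
proof (induction rule: lin_combs_induct)
  case (single t d)
  then show ?case
    using smult_assoc1[of c d "nov_eval f t"]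
    by (simp add: pm_smult_simps nov_ext_single nov_eval_closed)
next
  case (add p q)
  then show ?case
    using smult_r_distr[of c "nov_ext f p" "nov_ext f q"]
    by (simp add: pm_smult_simps nov_ext_add lin_combs_smult nov_ext_closed)
qed (simp add: pm_smult_simps)

lemma nov_ext_diff:
  assumes "p \<in> lin_combs (nov_terms A L)" "q \<in> lin_combs (nov_terms A L)"
  shows "nov_ext f (p - q) = nov_ext f p \<ominus> nov_ext f q"
  using nov_ext_add[OF assms(1) lin_combs_smult[OF assms(2), of "-1"]] assms
  by (simp add: pm_smult_minus_one nov_ext_smult[symmetric] a_minus_def minus_eq_smult nov_ext_closed)

lemma nov_ext_prod:
  assumes a: "a \<in> A"
    and p: "p \<in> lin_combs (nov_terms A L)" and q: "q \<in> lin_combs (nov_terms A L)"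
  shows "nov_ext f (magma_prod p a q) = nov_ext f p \<triangleright>[a] nov_ext f q"
  using p
proof (induction rule: lin_combs_induct)
  case zero
  then show ?case by (simp add: magma_prod_def nprod_zero a q nov_ext_closed)
next
  case (add p p')
  then show ?case
    by (simp add: magma_prod_add_left nov_ext_add nprod_add_left a q nov_ext_closed
        magma_prod_closed)
next
  case (single s c)
  show ?case
    using q
  proof (induction rule: lin_combs_induct)
    case zero
    then show ?case
      by (simp add: magma_prod_def nprod_zero a nov_ext_closed lin_combs_single single)
  next
    case (add q q')
    then show ?case
      by (simp add: magma_prod_add_right nov_ext_add nprod_add_right a nov_ext_closed
          magma_prod_closed lin_combs_single single)
  next
    case (single t d)
    have "Prod s a t \<in> nov_terms A L"
      using single \<open>s \<in> nov_terms A L\<close> a by (auto simp: nov_terms_def)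
    then show ?case
      using single \<open>s \<in> nov_terms A L\<close> a smult_assoc1[of c d "nov_eval f s \<triangleright>[a] nov_eval f t"]
        smult_assoc1[of d c "nov_eval f s \<triangleright>[a] nov_eval f t"]
      by (simp add: mult.commute[of d c] magma_prod_single nov_ext_single nprod_smult_left nprod_smult_right
          nov_eval_closed nprod_closed)
  qed
qed

lemma minus_self_zero: "x \<in> carrier N \<Longrightarrow> x \<ominus> x = \<zero>"
  by (simp add: a_minus_def M.r_neg)

lemma nov_ext_ideal: "p \<in> nov_ideal A L \<Longrightarrow> nov_ext f p = \<zero>"
proof (induction rule: nov_ideal.induct)
  case (add p q)
  then show ?case by (simp add: nov_ext_add nov_ideal_subset)
next
  case (smult p c)
  then show ?case by (simp add: nov_ext_smult nov_ideal_subset)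
next
  case (prod_left a p x)
  then show ?case by (simp add: nov_ext_prod nov_ideal_subset nprod_zero nov_ext_closed)
next
  case (prod_right a p x)
  then show ?case by (simp add: nov_ext_prod nov_ideal_subset nprod_zero nov_ext_closed)
next
  case (rel1 a b x y z)
  then show ?case
    by (simp add: nov_ext_prod nov_ext_diff lin_combs_diff magma_prod_closed
        novikov1[of a b "nov_ext f x" "nov_ext f y" "nov_ext f z"] nov_ext_closed nprod_closed
        minus_self_zero)
next
  case (rel2 a b x y z)
  then show ?case
    by (simp add: nov_ext_prod nov_ext_diff lin_combs_diff magma_prod_closed
        novikov2[of a b "nov_ext f x" "nov_ext f y" "nov_ext f z"] nov_ext_closed nprod_closed
        minus_self_zero)
next
  case (rel3 a b x y z)
  then show ?case
    by (simp add: nov_ext_prod nov_ext_diff lin_combs_diff magma_prod_closed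
        novikov3[of a b "nov_ext f x" "nov_ext f y" "nov_ext f z"] nov_ext_closed nprod_closed
        minus_self_zero)
qed simp

lemma nov_ext_coset:
  assumes "x \<in> lin_combs (nov_terms A L)" "y \<in> nov_coset A L x"
  shows "nov_ext f y = nov_ext f x"
proof -
  have d: "y - x \<in> nov_ideal A L" using assms(2) by (simp add: mem_nov_coset)
  have "nov_ext f ((y - x) + x) = nov_ext f (y - x) \<oplus> nov_ext f x"
    by (rule nov_ext_add[OF nov_ideal_subset[OF d] assms(1)])
  then show ?thesis using nov_ext_ideal[OF d] nov_ext_closed[OF assms(1)] by simp
qed

end

end

theorem free_multi_novikov_universal:
  fixes N :: "('k::field_char_0, 'a, 'v, 'm) nov_algebra_scheme"
  assumes N: "multi_novikov_algebra A N" and f: "f \<in> L \<rightarrow> carrier N"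
  shows "\<exists>h \<in> nov_hom A (free_multi_novikov A L) N. (\<forall>l\<in>L. h (free_gen A L l) = f l) \<and>
    (\<forall>h' \<in> nov_hom A (free_multi_novikov A L) N. (\<forall>l\<in>L. h' (free_gen A L l) = f l) \<longrightarrow>
      (\<forall>U\<in>carrier (free_multi_novikov A L). h' U = h U))"
proof -
  interpret multi_novikov_algebra A N by fact
  define h where "h U = nov_ext f (SOME x. x \<in> U)" for U
  let ?T = "lin_combs (nov_terms A L) :: (('a, _) nov_term \<Rightarrow>\<^sub>0 'k) set"
  have h: "h (nov_coset A L x) = nov_ext f x" if "x \<in> ?T" for x
  proof -
    have "x \<in> nov_coset A L x" by (simp add: mem_nov_coset nov_ideal.zero)
    then have "(SOME y. y \<in> nov_coset A L x) \<in> nov_coset A L x" by (rule someI)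
    then show ?thesis unfolding h_def by (rule nov_ext_coset[OF f that])
  qed
  have hom: "h \<in> nov_hom A (free_multi_novikov A L) N"
    by (auto simp: nov_hom_def free_carrier h free_add free_smult free_nprod lin_combs_add
        lin_combs_smult magma_prod_closed nov_ext_closed[OF f] nov_ext_add[OF f]
        nov_ext_smult[OF f] nov_ext_prod[OF f])
  have gen: "free_gen A L l = nov_coset A L (Poly_Mapping.single (Gen l) (1 :: 'k))" for l
    by (simp add: free_gen_def nov_coset_def)
  have gen_in: "Gen l \<in> nov_terms A L" if "l \<in> L" for l
    using that by (simp add: nov_terms_def)
  have hgen: "h (free_gen A L l) = f l" if "l \<in> L" for l
    using that f smult_one[of "f l"]
    by (auto simp: gen h lin_combs_single gen_in nov_ext_single[OF f])
  have uniq: "h' U = h U"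
    if h': "h' \<in> nov_hom A (free_multi_novikov A L) N"
      and hg: "\<forall>l\<in>L. h' (free_gen A L l) = f l"
      and U: "U \<in> carrier (free_multi_novikov A L)" for h' U
  proof -
    have cl: "nov_coset A L x \<in> carrier (free_multi_novikov A L)" if "x \<in> ?T" for x
      using that by (auto simp: free_carrier)
    have tm: "h' (nov_coset A L (Poly_Mapping.single t 1)) = nov_eval f t"
      if "t \<in> nov_terms A L" for t
      using that
    proof (induction t)
      case (Gen l)
      then show ?case using hg by (auto simp: gen nov_terms_def)
    next
      case (Prod s a t)
      then have st: "s \<in> nov_terms A L" "t \<in> nov_terms A L" "a \<in> A"
        by (auto simp: nov_terms_def)
      have "nov_coset A L (Poly_Mapping.single (Prod s a t) (1::'k))
          = nov_coset A L (Poly_Mapping.single s 1) \<triangleright>[a]\<^bsub>free_multi_novikov A L\<^esub>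
            nov_coset A L (Poly_Mapping.single t 1)"
        using st by (simp add: free_nprod lin_combs_single magma_prod_single)
      then show ?case
        using h' st Prod.IH by (simp add: nov_hom_def cl lin_combs_single)
    qed
    have "h' (nov_coset A L x) = nov_ext f x" if "x \<in> ?T" for x
      using that
    proof (induction rule: lin_combs_induct)
      case zero
      have "nov_coset A L (0 :: _ \<Rightarrow>\<^sub>0 'k) = 0 \<odot>\<^bsub>free_multi_novikov A L\<^esub> nov_coset A L 0"
        by (simp add: free_smult pm_smult_simps)
      then have "h' (nov_coset A L 0) = 0 \<odot>\<^bsub>N\<^esub> h' (nov_coset A L 0)"
        using h' cl[of 0] by (simp add: nov_hom_def) metis
      moreover have "h' (nov_coset A L 0) \<in> carrier N"
        using h' cl[of 0] by (auto simp: nov_hom_def)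
      ultimately show ?case by (simp add: nov_ext_zero[OF f])
    next
      case (single t c)
      have "nov_coset A L (Poly_Mapping.single t c)
          = c \<odot>\<^bsub>free_multi_novikov A L\<^esub> nov_coset A L (Poly_Mapping.single t 1)"
        by (simp add: free_smult pm_smult_simps)
      then show ?case
        using h' single tm by (simp add: nov_hom_def cl lin_combs_single nov_ext_single[OF f])
    next
      case (add p q)
      then show ?case
        using h' by (simp add: nov_hom_def free_add[symmetric] cl nov_ext_add[OF f])
    qed
    then show ?thesis using U by (auto simp: free_carrier h)
  qed
  show ?thesis using hom hgen uniq by blast
qed

end

(*
  In a multi-Novikov algebra one can form the symmetric brace of x_1, ..., x_k and y with labels
  a_1, ..., a_k, which in M_gen is the product x_1 ... x_k D^(a_1) ... D^(a_k) y. Identities (1) and (2)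
  make it symmetric in the x_i and in the a_i separately, and by (3) each slot x_i commutes with all
  right multiplications, so braces slide through one another. Hence an iterated brace whose innermost
  arguments are generators depends only on the multiset of its vertices, i.e. on a populated multi-index,
  and it may be brought into the form of a caterpillar. Caterpillars span the free algebra, since their
  span contains the generators and is closed under all products. The morphism to M_gen given by the
  universal property sends them to nonzero multiples (factorials, so characteristic zero matters) of
  distinct monomials, and every populated monomial occurs.
*)
theory Submission
  imports Defs "HOL-Library.Multiset"
begin

section \<open>Symmetric braces in a multi-Novikov algebra\<close>

text \<open>The populated condition is an edge count: a vertex \<open>(l, w)\<close> has
  \<open>len w\<close> children, so the sum of \<open>1 - len w\<close> over all vertices is the
  number of vertices minus the number of edges, which is 1 for a tree. Hence a populated multi-index
  has just enough variables \<open>(l, 0)\<close> to fill the free places of its other variables,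
  and some caterpillar has these vertices. Linear independence in the free algebra is never shown
  directly. The caterpillars span, their images are nonzero multiples of monomials, and equal
  monomials come from equal elements; injectivity on the span follows. The burden is therefore the
  equality of caterpillars with the same vertices. It splits into permuting leaves and permuting
  inner vertices, and both rest on the property \<open>commuting\<close>, which right
  multiplications have by (3) and every slot of a brace inherits. All permutation arguments are
  reduced to adjacent swaps of list entries.\<close>

lemma adjacent_swaps_imp_permutation_invariant:
  assumes swap: "\<And>xs x y ys. length (xs @ x # y # ys) = n \<Longrightarrow> f (xs @ x # y # ys) = f (xs @ y # x # ys)"
    and "mset xs = mset ys" "length xs = n"
  shows "f xs = f ys"
  using assms
proof (induction xs arbitrary: ys n f)
  case (Cons x xs)
  have "x \<in> set ys" using Cons.prems(2) by (metis list.set_intros(1) set_mset_mset)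
  then obtain us vs where ys: "ys = us @ x # vs" by (meson split_list)
  have len: "length (us @ x # vs) = n" using Cons.prems ys by (metis size_mset)
  \<comment> \<open>\<open>x\<close> is bubbled to the front past its left neighbour; the length is
    carried along because swaps are only available for lists of length \<open>n\<close>.\<close>
  have "length (us @ x # vs) = n \<Longrightarrow> f (us @ x # vs) = f (x # us @ vs)" for us vs
  proof (induction us arbitrary: vs rule: rev_induct)
    case (snoc u us)
    then show ?case using Cons.prems(1)[of us u x vs] snoc.IH[of "u # vs"] by simp
  qed simp
  then have "f ys = f (x # us @ vs)" using len ys by simp
  moreover have "f (x # xs) = f (x # us @ vs)"
  proof (rule Cons.IH[of "n - 1" "\<lambda>xs. f (x # xs)"])
    fix as bs :: "'a list" and a b assume "length (as @ a # b # bs) = n - 1"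
    then show "f (x # as @ a # b # bs) = f (x # as @ b # a # bs)"
      using Cons.prems(1)[of "x # as" a b bs] len by simp
  qed (use Cons.prems ys in auto)
  ultimately show ?case by simp
qed simp

lemma split_list_two:
  assumes "length (us @ u # v # vs) = length as"
  shows "\<exists>cs a b ds. length cs = length us \<and> as = cs @ a # b # ds"
proof (intro exI conjI)
  let ?n = "length us"
  show "as = take ?n as @ as ! ?n # as ! Suc ?n # drop (Suc (Suc ?n)) as"
    using assms by (simp add: Cons_nth_drop_Suc)
qed (use assms in simp)

text \<open>Carrier-free form on a whole type, so that \<open>span\<close>, \<open>subspace\<close>
  and type class arithmetic apply. The identities are demanded for every label of the type.\<close>

locale total_multi_novikov = vector_space scale
  for scale :: "'k::field_char_0 \<Rightarrow> 'v::ab_group_add \<Rightarrow> 'v" +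
  fixes nov :: "'v \<Rightarrow> 'a \<Rightarrow> 'v \<Rightarrow> 'v"  (\<open>(_ \<star>[_] _)\<close> [71, 0, 71] 70)
  assumes nov_add_left: "(x + y) \<star>[a] z = (x \<star>[a] z) + (y \<star>[a] z)"
    and nov_add_right: "x \<star>[a] (y + z) = (x \<star>[a] y) + (x \<star>[a] z)"
    and nov_scale_left: "scale c x \<star>[a] y = scale c (x \<star>[a] y)"
    and nov_scale_right: "x \<star>[a] scale c y = scale c (x \<star>[a] y)"
    and nov_left_symmetric: "((x \<star>[a] y) \<star>[b] z) - (x \<star>[a] (y \<star>[b] z))
      = ((y \<star>[a] x) \<star>[b] z) - (y \<star>[a] (x \<star>[b] z))"
    and nov_label_symmetric: "((x \<star>[a] y) \<star>[b] z) - (x \<star>[a] (y \<star>[b] z))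
      = ((x \<star>[b] y) \<star>[a] z) - (x \<star>[b] (y \<star>[a] z))"
    and nov_right_commute: "(x \<star>[a] y) \<star>[b] z = (x \<star>[b] z) \<star>[a] y"
begin

lemma nov_zero_right [simp]: "x \<star>[a] 0 = 0"
  using nov_add_right[of x a 0 0] by simp

lemma nov_diff_right: "x \<star>[a] (y - z) = (x \<star>[a] y) - (x \<star>[a] z)"
  using nov_add_right[of x a "y - z" z] by (simp add: algebra_simps)

lemma nov_sum_right: "x \<star>[a] (\<Sum>i\<in>I. f i) = (\<Sum>i\<in>I. x \<star>[a] f i)"
  by (induction I rule: infinite_finite_induct) (auto simp: nov_add_right)

section \<open>Braces and permutations of their (label, argument) pairs\<close>

definition upd :: "'a \<Rightarrow> 'v \<Rightarrow> 'a \<times> 'v \<Rightarrow> 'a \<times> 'v" where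
  "upd a x p = (fst p, x \<star>[a] snd p)"

text \<open>\<open>brace [(a\<^sub>1, x\<^sub>1), \<dots>, (a\<^sub>k, x\<^sub>k)] y\<close> plays the role of
  \<open>x\<^sub>1 \<cdots> x\<^sub>k D\<^bsup>(a\<^sub>1)\<^esup> \<cdots> D\<^bsup>(a\<^sub>k)\<^esup> y\<close>; the recursion is the Leibniz rule for
  \<open>x\<^sub>1 D\<^bsup>(a\<^sub>1)\<^esup>\<close> solved for the leading term.\<close>

function brace :: "('a \<times> 'v) list \<Rightarrow> 'v \<Rightarrow> 'v" where
  "brace [] y = y"
| "brace ((a, x) # ps) y = (x \<star>[a] brace ps y) - (\<Sum>i<length ps. brace (ps[i := upd a x (ps ! i)]) y)"
  by pat_completeness auto
termination by (relation "measure (\<lambda>(ps, y). length ps)") auto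

lemma brace_add:
  "i < length ps \<Longrightarrow> brace (ps[i := (a, u + v)]) y = brace (ps[i := (a, u)]) y + brace (ps[i := (a, v)]) y"
proof (induction "length ps" arbitrary: ps i a u v)
  case (Suc n)
  then obtain b x qs where ps: "ps = (b, x) # qs" by (metis length_Suc_conv surj_pair)
  have IH: "j < length qs \<Longrightarrow> length rs = length qs \<Longrightarrow>
      brace (rs[j := (c, s + t)]) y = brace (rs[j := (c, s)]) y + brace (rs[j := (c, t)]) y" for j c s t rs
    using Suc ps by simp
  show ?case
  proof (cases i)
    case 0
    then show ?thesis by (simp add: ps upd_def nov_add_left IH sum.distrib)
  next
    case i: (Suc k)
    then have k: "k < length qs" using Suc.prems ps by simp
    have "brace (qs[k := (a, u + v), j := upd b x (qs[k := (a, u + v)] ! j)]) y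
        = brace (qs[k := (a, u), j := upd b x (qs[k := (a, u)] ! j)]) y
          + brace (qs[k := (a, v), j := upd b x (qs[k := (a, v)] ! j)]) y" if "j < length qs" for j
    \<comment> \<open>The correction at \<open>j = k\<close> hits the split slot itself and is split
      by additivity of the product on the right; all other corrections update a different
      slot.\<close>
    proof (cases "j = k")
      case True
      then show ?thesis using k by (simp add: upd_def nov_add_right IH)
    next
      case False
      then show ?thesis using k that by (simp add: list_update_swap[of k j] IH)
    qed
    then show ?thesis using k by (simp add: ps i IH nov_add_right sum.distrib)
  qed
qed simp

text \<open>Trading two pairs exchanges arguments and labels simultaneously, so the associator of
  \<open>x\<close>, \<open>z\<close>, \<open>t\<close> must be invariant under both: (1) followed by
  (2). Applied to the leading term and to each correction, this makes the twofold expansion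
  symmetric.\<close>

lemma brace_swap_front: "brace (p # q # ps) y = brace (q # p # ps) y"
proof -
  obtain a x b z where pq: "p = (a, x)" "q = (b, z)" by (metis surj_pair)
  define n where "n = length ps"
  \<comment> \<open>\<open>B\<close> collects the corrections in which both actions fall on one slot
    or only one acts; \<open>G\<close> those hitting two different slots, hence its value 0 on the
    diagonal.\<close>
  define B where "B f i = brace (ps[i := (fst (ps ! i), f (snd (ps ! i)))]) y" for f i
  define G where "G f g i j = (if i = j then 0 else
    brace (ps[i := (fst (ps ! i), f (snd (ps ! i))), j := (fst (ps ! j), g (snd (ps ! j)))]) y)"
    for f g i j
  have G_swap: "G f g i j = G g f j i" for f g i j
    by (auto simp: G_def list_update_swap)
  have B_add: "(\<Sum>i<n. B f i) + (\<Sum>i<n. B g i) = (\<Sum>i<n. B (\<lambda>t. f t + g t) i)" for f g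
    by (simp add: B_def n_def brace_add sum.distrib)
  have expand: "brace ((a, x) # (b, z) # ps) y
      = ((x \<star>[a] (z \<star>[b] brace ps y)) - ((x \<star>[a] z) \<star>[b] brace ps y))
      - ((\<Sum>i<n. x \<star>[a] B (\<lambda>t. z \<star>[b] t) i) + (\<Sum>i<n. z \<star>[b] B (\<lambda>t. x \<star>[a] t) i))
      + (\<Sum>i<n. B (\<lambda>t. ((x \<star>[a] z) \<star>[b] t) + (z \<star>[b] (x \<star>[a] t))) i)
      + (\<Sum>i<n. \<Sum>j<n. G (\<lambda>t. x \<star>[a] t) (\<lambda>t. z \<star>[b] t) i j)" for a x b z
  proof -
    have inner: "brace ((b, z) # ps[i := upd a x (ps ! i)]) y
       = (z \<star>[b] B (\<lambda>t. x \<star>[a] t) i)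
        - (B (\<lambda>t. z \<star>[b] (x \<star>[a] t)) i + (\<Sum>j<n. G (\<lambda>t. x \<star>[a] t) (\<lambda>t. z \<star>[b] t) i j))"
      if i: "i < n" for i
    proof -
      have eq: "brace (ps[i := upd a x (ps ! i), j := upd b z (ps[i := upd a x (ps ! i)] ! j)]) y
          = (if j = i then B (\<lambda>t. z \<star>[b] (x \<star>[a] t)) i else 0)
            + G (\<lambda>t. x \<star>[a] t) (\<lambda>t. z \<star>[b] t) i j" for j
        using i by (auto simp: B_def G_def upd_def n_def)
      have "(\<Sum>j<n. brace (ps[i := upd a x (ps ! i), j := upd b z (ps[i := upd a x (ps ! i)] ! j)]) y)
          = B (\<lambda>t. z \<star>[b] (x \<star>[a] t)) i + (\<Sum>j<n. G (\<lambda>t. x \<star>[a] t) (\<lambda>t. z \<star>[b] t) i j)"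
        unfolding eq sum.distrib using i by simp
      then show ?thesis by (simp add: n_def[symmetric] B_def[of "\<lambda>t. x \<star>[a] t"] upd_def[symmetric])
    qed
    have "brace ((a, x) # (b, z) # ps) y
      = (x \<star>[a] brace ((b, z) # ps) y) - brace ((b, x \<star>[a] z) # ps) y
        - (\<Sum>i<n. brace ((b, z) # ps[i := upd a x (ps ! i)]) y)"
      by (simp add: n_def sum.lessThan_Suc_shift upd_def del: sum.lessThan_Suc brace.simps(2))
        (simp add: upd_def sum.lessThan_Suc_shift del: sum.lessThan_Suc)
    also have "(\<Sum>i<n. brace ((b, z) # ps[i := upd a x (ps ! i)]) y)
      = (\<Sum>i<n. (z \<star>[b] B (\<lambda>t. x \<star>[a] t) i)
        - (B (\<lambda>t. z \<star>[b] (x \<star>[a] t)) i + (\<Sum>j<n. G (\<lambda>t. x \<star>[a] t) (\<lambda>t. z \<star>[b] t) i j)))"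
      by (intro sum.cong refl inner) simp
    also have "x \<star>[a] brace ((b, z) # ps) y
        = (x \<star>[a] (z \<star>[b] brace ps y)) - (\<Sum>i<n. x \<star>[a] B (\<lambda>t. z \<star>[b] t) i)"
      by (simp add: nov_diff_right nov_sum_right B_def upd_def n_def)
    also have "brace ((b, x \<star>[a] z) # ps) y
        = ((x \<star>[a] z) \<star>[b] brace ps y) - (\<Sum>i<n. B (\<lambda>t. (x \<star>[a] z) \<star>[b] t) i)"
      by (simp add: B_def upd_def n_def)
    finally show ?thesis
      by (simp add: B_add[symmetric] sum.distrib sum_subtractf algebra_simps)
  qed
  have assoc: "(x \<star>[a] (z \<star>[b] t)) - ((x \<star>[a] z) \<star>[b] t) = (z \<star>[b] (x \<star>[a] t)) - ((z \<star>[b] x) \<star>[a] t)" for t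
    using nov_left_symmetric[of x a z b t] nov_label_symmetric[of z a x b t]
    by (simp add: algebra_simps)
  have assoc': "((x \<star>[a] z) \<star>[b] t) + (z \<star>[b] (x \<star>[a] t)) = ((z \<star>[b] x) \<star>[a] t) + (x \<star>[a] (z \<star>[b] t))" for t
    using assoc[of t] by (simp add: algebra_simps)
  have "(\<Sum>i<n. \<Sum>j<n. G f g i j) = (\<Sum>i<n. \<Sum>j<n. G g f i j)" for f g
    by (subst sum.swap) (simp add: G_swap[of f g])
  moreover have "(\<Sum>i<n. B (\<lambda>t. ((x \<star>[a] z) \<star>[b] t) + (z \<star>[b] (x \<star>[a] t))) i)
      = (\<Sum>i<n. B (\<lambda>t. ((z \<star>[b] x) \<star>[a] t) + (x \<star>[a] (z \<star>[b] t))) i)"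
    by (simp only: assoc')
  ultimately show ?thesis unfolding pq expand assoc
    by (simp only: add.commute)
qed

text \<open>The corrections do not change the number of entries, so if braces of length
  \<open>n\<close> depend only on the multiset of pairs, the whole correction sum does too.\<close>

lemma brace_Cons_cong:
  assumes "\<And>ps qs. length ps = n \<Longrightarrow> mset ps = mset qs \<Longrightarrow> brace ps y = brace qs y"
    and "length ps = n" "mset ps = mset qs"
  shows "brace (p # ps) y = brace (p # qs) y"
proof -
  obtain a x where p: "p = (a, x)" by force
  \<comment> \<open>Any listing of \<open>M\<close> may be chosen: on multisets of size
    \<open>n\<close> the hypothesis makes the value independent of it.\<close>
  define F where "F M = brace (SOME ps. mset ps = M) y" for M
  have F: "brace rs y = F (mset rs)" if "length rs = n" for rs
    unfolding F_def by (rule assms(1)[OF that]) (rule sym, rule someI[of _ rs], simp)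
  have sum: "(\<Sum>i<length rs. brace (rs[i := upd a x (rs ! i)]) y)
      = sum_mset (image_mset (\<lambda>r. F (mset rs - {#r#} + {#upd a x r#})) (mset rs))"
    if "length rs = n" for rs
  proof -
    have "(\<Sum>i<length rs. brace (rs[i := upd a x (rs ! i)]) y)
        = (\<Sum>i<length rs. (map (\<lambda>r. F (mset rs - {#r#} + {#upd a x r#})) rs) ! i)"
      by (intro sum.cong refl) (simp add: F that mset_update)
    also have "\<dots> = sum_list (map (\<lambda>r. F (mset rs - {#r#} + {#upd a x r#})) rs)"
      by (simp add: sum_list_sum_nth atLeast0LessThan)
    finally show ?thesis by (simp only: mset_map[symmetric] sum_mset_sum_list)
  qed
  have len: "length qs = n" using assms by (metis size_mset)
  show ?thesis
    by (simp only: p brace.simps sum[OF assms(2)] sum[OF len] F[OF assms(2)] F[OF len] assms(3))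
qed

lemma brace_permute: "mset ps = mset qs \<Longrightarrow> brace ps y = brace qs y"
proof (induction "length ps" arbitrary: ps qs)
  case (Suc n)
  show ?case
  proof (rule adjacent_swaps_imp_permutation_invariant[where n = "Suc n" and f = "\<lambda>ps. brace ps y"])
    fix xs ys :: "('a \<times> 'v) list" and p q assume len: "length (xs @ p # q # ys) = Suc n"
    show "brace (xs @ p # q # ys) y = brace (xs @ q # p # ys) y"
    proof (cases xs)
      case Nil
      then show ?thesis using brace_swap_front by simp
    next
      case (Cons r rs)
      have "brace (r # (rs @ p # q # ys)) y = brace (r # (rs @ q # p # ys)) y"
        by (rule brace_Cons_cong[of n]) (use Suc.hyps(1) len Cons in auto)
      then show ?thesis by (simp add: Cons)
    qed
  qed (use Suc in auto)
qed simp

section \<open>Independent permutations of labels and of arguments\<close>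

lemma brace_swap_values_end: "brace (ps @ [(a, u), (b, v)]) y = brace (ps @ [(a, v), (b, u)]) y"
proof (induction "length ps" arbitrary: ps u v)
  case 0
  \<comment> \<open>With two entries the claim is identity (1): the arguments trade places, the
    labels stay.\<close>
  then show ?case using nov_left_symmetric[of u a v b y] 
    by (simp add: upd_def algebra_simps)
next
  case (Suc n)
  then obtain c x qs where ps: "ps = (c, x) # qs" by (metis length_Suc_conv surj_pair)
  have n: "length qs = n" using Suc ps by simp
  have IH: "length rs = n \<Longrightarrow> brace (rs @ [(a, u), (b, v)]) y = brace (rs @ [(a, v), (b, u)]) y" for rs u v
    using Suc.hyps(1) by simp
  have "brace (ps @ [(a, u), (b, v)]) y = (x \<star>[c] brace (qs @ [(a, u), (b, v)]) y)
    - ((\<Sum>i<n. brace ((qs[i := upd c x (qs ! i)]) @ [(a, u), (b, v)]) y)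
      + brace (qs @ [(a, x \<star>[c] u), (b, v)]) y + brace (qs @ [(a, u), (b, x \<star>[c] v)]) y)" for u v
    by (simp add: ps n upd_def list_update_append nth_append)
  \<comment> \<open>The pair stands at the end so that the recursion peels off the other entries.
    The last two corrections are interchanged by the induction hypothesis.\<close>
  then show ?case using IH[OF n] IH n by (simp add: add.commute add.left_commute)
qed

lemma brace_swap_values: "brace (ps @ (a, u) # (b, v) # qs) y = brace (ps @ (a, v) # (b, u) # qs) y"
  using brace_swap_values_end[of "ps @ qs" a u b v y]
    brace_permute[of "ps @ (a, u) # (b, v) # qs" "(ps @ qs) @ [(a, u), (b, v)]" y]
    brace_permute[of "ps @ (a, v) # (b, u) # qs" "(ps @ qs) @ [(a, v), (b, u)]" y]
  by simp

text \<open>Labels and arguments are kept in separate lists because each list can be permuted on its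
  own. \<open>zip\<close> truncates, hence the length hypotheses below.\<close>

definition polybrace :: "'a list \<Rightarrow> 'v list \<Rightarrow> 'v \<Rightarrow> 'v" where
  "polybrace as xs y = brace (zip as xs) y"

lemma polybrace_permute:
  assumes "mset as = mset bs" "mset xs = mset zs" "length as = length xs"
  shows "polybrace as xs y = polybrace bs zs y"
proof -
  have len: "length bs = length xs" "length zs = length xs"
    using assms by (metis size_mset)+
  have "polybrace as xs y = polybrace as zs y"
    unfolding polybrace_def
  proof (rule adjacent_swaps_imp_permutation_invariant[where n = "length as" and f = "\<lambda>xs. brace (zip as xs) y"])
    fix us vs :: "'v list" and u v assume "length (us @ u # v # vs) = length as"
    then obtain cs a b ds where "length cs = length us" "as = cs @ a # b # ds"
      using split_list_two[of us] by blast
    then show "brace (zip as (us @ u # v # vs)) y = brace (zip as (us @ v # u # vs)) y"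
      using brace_swap_values by simp
  qed (use assms in auto)
  also have "\<dots> = polybrace bs zs y"
    unfolding polybrace_def
  proof (rule adjacent_swaps_imp_permutation_invariant[where n = "length as" and f = "\<lambda>as. brace (zip as zs) y"])
    fix us vs :: "'a list" and a b assume "length (us @ a # b # vs) = length as"
    then have "length (us @ a # b # vs) = length zs" using len assms by simp
    then obtain cs u v ds where zs: "length cs = length us" "zs = cs @ u # v # ds"
      using split_list_two[of us] by blast
    \<comment> \<open>Swapping two labels amounts to swapping the two arguments and then the two
      pairs.\<close>
    then show "brace (zip (us @ a # b # vs) zs) y = brace (zip (us @ b # a # vs) zs) y"
      using brace_swap_values[of "zip us cs" a u b v "zip vs ds" y]
        brace_permute[of "zip us cs @ (a, v) # (b, u) # zip vs ds" "zip us cs @ (b, u) # (a, v) # zip vs ds"]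
      by simp
  qed (use assms in auto)
  finally show ?thesis .
qed

end


section \<open>Caterpillars\<close>

definition pm_of_list :: "'b list \<Rightarrow> 'b \<Rightarrow>\<^sub>0 nat" where
  "pm_of_list xs = (\<Sum>x\<leftarrow>xs. Poly_Mapping.single x 1)"

lemma pm_of_list_simps [simp]:
  "pm_of_list [] = 0" "pm_of_list (x # xs) = Poly_Mapping.single x 1 + pm_of_list xs"
  "pm_of_list (xs @ ys) = pm_of_list xs + pm_of_list ys"
  by (simp_all add: pm_of_list_def)

lemma lookup_pm_of_list: "Poly_Mapping.lookup (pm_of_list xs) x = count (mset xs) x"
  by (induction xs) (auto simp: lookup_add lookup_single)

lemma pm_of_list_eq_iff: "pm_of_list xs = pm_of_list ys \<longleftrightarrow> mset xs = mset ys"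
  by (auto simp: poly_mapping_eq_iff fun_eq_iff lookup_pm_of_list multiset_eq_iff)

lemma keys_pm_of_list [simp]: "Poly_Mapping.keys (pm_of_list xs) = set xs"
  by (auto simp: in_keys_iff lookup_pm_of_list)

lemma pm_of_list_surj: "\<exists>xs. pm_of_list xs = w"
proof -
  have "finite {x. 0 < Poly_Mapping.lookup w x}" by simp
  then have "count (Abs_multiset (Poly_Mapping.lookup w)) = Poly_Mapping.lookup w"
    by (rule count_Abs_multiset)
  moreover obtain xs where "mset xs = Abs_multiset (Poly_Mapping.lookup w)" using ex_mset by blast
  ultimately have "pm_of_list xs = w" by (simp add: poly_mapping_eq_iff fun_eq_iff lookup_pm_of_list)
  then show ?thesis by blast
qed

lemma len_pm_of_list [simp]: "len (pm_of_list xs) = length xs"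
proof -
  have "len (pm_of_list xs) = (\<Sum>x\<in>set_mset (mset xs). count (mset xs) x)"
    by (simp add: len_def lookup_pm_of_list)
  also have "\<dots> = size (mset xs)" by (rule size_multiset_overloaded_eq[symmetric])
  finally show ?thesis by simp
qed

text \<open>An arbitrary listing suffices, since braces depend only on the multiset of
  labels.\<close>

definition list_of_pm :: "('b \<Rightarrow>\<^sub>0 nat) \<Rightarrow> 'b list" where
  "list_of_pm w = (SOME xs. pm_of_list xs = w)"

lemma pm_of_list_of_pm [simp]: "pm_of_list (list_of_pm w) = w"
  unfolding list_of_pm_def by (rule someI_ex[OF pm_of_list_surj])

lemma set_list_of_pm [simp]: "set (list_of_pm w) = Poly_Mapping.keys w"
  by (metis keys_pm_of_list pm_of_list_of_pm)

lemma length_list_of_pm [simp]: "length (list_of_pm w) = len w"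
  by (metis len_pm_of_list pm_of_list_of_pm)

lemma mset_list_of_pm_add_single:
  "mset (list_of_pm (w + Poly_Mapping.single a 1)) = mset (a # list_of_pm w)"
  by (rule pm_of_list_eq_iff[THEN iffD1]) (simp add: add.commute)

lemma len_zero [simp]: "len 0 = 0"
  by (simp add: len_def)

lemma len_single [simp]: "len (Poly_Mapping.single x k) = k"
  by (simp add: len_def)

lemma len_add [simp]: "len (v + w) = len v + len w"
  by (metis len_pm_of_list length_append pm_of_list_of_pm pm_of_list_simps(3))

lemma len_eq_0_iff [simp]: "len w = 0 \<longleftrightarrow> w = 0"
  by (metis len_zero length_0_conv length_list_of_pm pm_of_list_of_pm pm_of_list_simps(1))

lemma single_1_nonzero [simp]: "Poly_Mapping.single a (1 :: nat) \<noteq> 0" "Poly_Mapping.single a (Suc 0) \<noteq> 0"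
  by (metis len_single len_zero zero_neq_one, metis len_single len_zero nat.distinct(1))

text \<open>For \<open>w \<noteq> 0\<close> this is minus the contribution \<open>1 - len w\<close>
  in the populated condition; the subtraction truncates only at the leaves
  \<open>(l, 0)\<close>.\<close>

definition excess :: "('a, 'l) zvar \<Rightarrow> nat" where
  "excess n = len (snd n) - 1"

abbreviation total_excess :: "('a, 'l) zvar list \<Rightarrow> nat" where
  "total_excess ns \<equiv> (\<Sum>n\<leftarrow>ns. excess n)"

text \<open>The possible inner vertices; the remaining variables \<open>(l, 0)\<close> stand for
  generators, that is, leaves.\<close>

definition nodes :: "'a set \<Rightarrow> 'l set \<Rightarrow> ('a, 'l) zvar set" where
  "nodes A L = L \<times> (fin_maps A - {0})"

section \<open>Linear operators commuting with right multiplications\<close>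

context total_multi_novikov
begin

definition commuting :: "('v \<Rightarrow> 'v) \<Rightarrow> bool" where
  "commuting E \<longleftrightarrow> (\<forall>u v. E (u + v) = E u + E v) \<and> (\<forall>c u. E (scale c u) = scale c (E u)) \<and>
    (\<forall>u a w. E (u \<star>[a] w) = E u \<star>[a] w)"

lemma commuting_diff: "commuting E \<Longrightarrow> E (u - v) = E u - E v"
  unfolding commuting_def by (metis add_diff_cancel_right' diff_add_cancel)

lemma commuting_sum: "commuting E \<Longrightarrow> E (\<Sum>i\<in>I. f i) = (\<Sum>i\<in>I. E (f i))"
proof -
  assume E: "commuting E"
  have "E 0 = 0" using commuting_diff[OF E, of 0 0] by simp
  then show ?thesis
    using E by (induction I rule: infinite_finite_induct) (auto simp: commuting_def)
qed

lemma brace_update: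
  "i < length ps \<Longrightarrow> brace (ps[i := p]) y = brace (p # take i ps @ drop (Suc i) ps) y"
  by (rule brace_permute) (simp add: upd_conv_take_nth_drop)

text \<open>Each correction has \<open>u \<star>[a] x\<close> in one slot. Moving that slot to the
  front gives a shorter brace, where the induction hypothesis applies, and \<open>E\<close> passes
  through the right multiplication.\<close>

lemma commuting_apply_brace:
  assumes E: "commuting E"
  shows "E (brace ((a, u) # ps) y) = brace ((a, E u) # ps) y"
proof (induction "length ps" arbitrary: a u ps rule: less_induct)
  case less
  have "E (brace (ps[i := upd a u (ps ! i)]) y) = brace (ps[i := upd a (E u) (ps ! i)]) y"
    if "i < length ps" for i
    using that less[of "take i ps @ drop (Suc i) ps"] E
    by (simp add: brace_update upd_def commuting_def del: brace.simps)
  then show ?case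
    using E by (simp add: commuting_diff commuting_sum) (simp add: commuting_def)
qed

lemma commuting_scale: "commuting (scale c)"
  by (simp add: commuting_def nov_scale_left scale_right_distrib scale_left_commute)

lemma commuting_right_mult: "commuting (\<lambda>u. u \<star>[c] v)"
  by (simp add: commuting_def nov_add_left nov_scale_left nov_right_commute[of _ _ _ c v])

text \<open>Scalings and, by (3), right multiplications are commuting operators, so they pass into a
  slot by the previous lemma; read backwards, the slot commutes with them.\<close>

lemma commuting_brace: "commuting (\<lambda>u. brace ((a, u) # ps) y)"
  unfolding commuting_def
  using brace_add[of 0 "(a, 0) # ps" a _ _ y] commuting_apply_brace[OF commuting_scale, of _ a _ ps y]
    commuting_apply_brace[OF commuting_right_mult, of a _ ps y]
  by (simp del: brace.simps)

lemma commuting_comp: "commuting E \<Longrightarrow> commuting F \<Longrightarrow> commuting (\<lambda>u. E (F u))"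
  by (simp add: commuting_def)

lemma commuting_polybrace: "as \<noteq> [] \<Longrightarrow> commuting (\<lambda>u. polybrace as (u # xs) y)"
  by (cases as) (simp_all add: polybrace_def commuting_brace del: brace.simps)

lemma commuting_apply_polybrace:
  "commuting E \<Longrightarrow> as \<noteq> [] \<Longrightarrow> E (polybrace as (u # xs) y) = polybrace as (E u # xs) y"
  by (cases as) (simp_all add: polybrace_def commuting_apply_brace del: brace.simps)

lemma nov_polybrace:
  assumes "length as = length xs"
  shows "u \<star>[a] polybrace as xs y = polybrace (a # as) (u # xs) y
    + (\<Sum>i<length xs. polybrace as (xs[i := u \<star>[a] (xs ! i)]) y)"
proof -
  have "zip as (xs[i := u \<star>[a] (xs ! i)]) = (zip as xs)[i := upd a u (zip as xs ! i)]"
    if "i < length xs" for i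
    using that assms by (simp add: list_eq_iff_nth_eq upd_def nth_list_update)
  then show ?thesis by (simp add: polybrace_def assms)
qed

text \<open>\<open>u\<close> is the child on the spine. It comes last so that
  \<open>node_op g n xs\<close> is an operator, to which \<open>commuting\<close> applies.\<close>

definition node_op :: "('l \<Rightarrow> 'v) \<Rightarrow> ('a, 'l) zvar \<Rightarrow> 'v list \<Rightarrow> 'v \<Rightarrow> 'v" where
  "node_op g n xs u = polybrace (list_of_pm (snd n)) (u # xs) (g (fst n))"

text \<open>A variable \<open>(l, w)\<close> with \<open>w \<noteq> 0\<close> is a vertex with \<open>len w\<close> children. In a caterpillar one child
  is the rest of the spine and the other \<open>excess (l, w)\<close> children are taken off the list of leaves.\<close>

primrec caterpillar :: "('l \<Rightarrow> 'v) \<Rightarrow> ('a, 'l) zvar list \<Rightarrow> 'v list \<Rightarrow> 'v \<Rightarrow> 'v" where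
  "caterpillar g [] xs u = u"
| "caterpillar g (n # ns) xs u
    = node_op g n (take (excess n) xs) (caterpillar g ns (drop (excess n) xs) u)"

lemma list_of_pm_nonempty: "w \<noteq> 0 \<Longrightarrow> list_of_pm w \<noteq> []"
  by (metis pm_of_list_of_pm pm_of_list_simps(1))

lemma commuting_node_op: "snd n \<noteq> 0 \<Longrightarrow> commuting (node_op g n xs)"
  unfolding node_op_def by (intro commuting_polybrace list_of_pm_nonempty)

lemma commuting_apply_node_op:
  "commuting E \<Longrightarrow> snd n \<noteq> 0 \<Longrightarrow> E (node_op g n xs u) = node_op g n xs (E u)"
  unfolding node_op_def by (intro commuting_apply_polybrace list_of_pm_nonempty)

lemma node_op_permute:
  assumes "mset (u # xs) = mset (v # ys)" "len (snd n) = Suc (length xs)"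
  shows "node_op g n xs u = node_op g n ys v"
  unfolding node_op_def using assms by (intro polybrace_permute) auto

lemma commuting_caterpillar:
  "\<forall>n\<in>set ns. snd n \<noteq> 0 \<Longrightarrow> commuting (caterpillar g ns xs)"
proof (induction ns arbitrary: xs)
  case (Cons n ns)
  then show ?case using commuting_comp[OF commuting_node_op[of n g "take (excess n) xs"], of "caterpillar g ns (drop (excess n) xs)"]
    by simp
qed (simp add: commuting_def)

lemma caterpillar_append:
  "length xs = total_excess ns \<Longrightarrow>
    caterpillar g (ns @ ms) (xs @ ys) u = caterpillar g ns xs (caterpillar g ms ys u)"
  by (induction ns arbitrary: xs) auto

text \<open>The end of the spine counts as a leaf here. Leaves of one vertex trade by symmetry of
  its brace, and leaves of different vertices meet at a common vertex after sliding.\<close>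

lemma caterpillar_permute_leaves:
  assumes "\<forall>n\<in>set ns. snd n \<noteq> 0" "length xs = total_excess ns" "mset (u # xs) = mset (v # ys)"
  shows "caterpillar g ns xs u = caterpillar g ns ys v"
  using assms
proof (induction ns arbitrary: xs u v ys)
  case (Cons n ns)
  define k where "k = excess n"
  have n: "snd n \<noteq> 0" and len: "len (snd n) = Suc k"
    using Cons.prems(1) len_eq_0_iff[of "snd n"] unfolding k_def excess_def by (auto simp del: len_eq_0_iff)
  \<comment> \<open>All leaves form one list, with the end of the spine inserted at position
    \<open>k\<close>, right after the leaves of the top vertex; adjacent swaps then reach every
    permutation.\<close>
  define f where "f zs = node_op g n (take k zs) (caterpillar g ns (drop (Suc k) zs) (zs ! k))" for zs
  have swap: "f (ps @ p # q # qs) = f (ps @ q # p # qs)"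
    if l: "length (ps @ p # q # qs) = Suc (k + total_excess ns)" for ps p q qs
  proof -
    consider "length ps + 2 \<le> k" | "length ps + 1 = k" | "length ps \<ge> k" by linarith
    then show ?thesis
    proof cases
      case 1
      then obtain j where k: "k = length ps + 2 + j" using le_Suc_ex by blast
      have "drop (Suc k) (ps @ p # q # qs) = drop (Suc k) (ps @ q # p # qs)"
        "(ps @ p # q # qs) ! k = (ps @ q # p # qs) ! k"
        by (simp_all add: k nth_append numeral_3_eq_3)
      then show ?thesis unfolding f_def
        by (simp only:, intro node_op_permute) (use l len in \<open>simp_all add: k\<close>)
    next
      \<comment> \<open>The swap between a leaf of the top vertex and the end of the spine: the
        lower part \<open>?E\<close> slides out of the top vertex, after which both are children of
        that vertex.\<close>
      case 2
      let ?E = "caterpillar g ns qs"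
      have E: "commuting ?E" using Cons.prems(1) by (intro commuting_caterpillar) auto
      have k: "k = Suc (length ps)" using 2 by simp
      have "node_op g n (ps @ [a]) (?E b) = ?E (node_op g n (ps @ [a]) b)" for a b
        using commuting_apply_node_op[OF E n] by simp
      moreover have "node_op g n (ps @ [p]) q = node_op g n (ps @ [q]) p"
        by (rule node_op_permute) (use len k in auto)
      ultimately show ?thesis by (simp add: f_def k nth_append)
    next
      case 3
      have e: "caterpillar g ns (drop (Suc k) (ps @ p # q # qs)) ((ps @ p # q # qs) ! k)
          = caterpillar g ns (drop (Suc k) (ps @ q # p # qs)) ((ps @ q # p # qs) ! k)"
      proof (rule Cons.IH)
        have m: "mset (zs ! k # drop (Suc k) zs) = mset (drop k zs)" if "k < length zs" for zs
          using that by (simp only: Cons_nth_drop_Suc)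
        have k: "k < length (ps @ p # q # qs)" "k < length (ps @ q # p # qs)" using 3 by simp_all
        have "mset (drop k (ps @ p # q # qs)) = mset (drop k (ps @ q # p # qs))"
          using 3 by simp
        then show "mset ((ps @ p # q # qs) ! k # drop (Suc k) (ps @ p # q # qs))
            = mset ((ps @ q # p # qs) ! k # drop (Suc k) (ps @ q # p # qs))"
          by (simp only: m[OF k(1)] m[OF k(2)])
      qed (use Cons.prems l in auto)
      have "take k (ps @ p # q # qs) = take k (ps @ q # p # qs)" using 3 by simp
      then show ?thesis unfolding f_def e by simp
    qed
  qed
  have cat: "caterpillar g (n # ns) zs w = f (take k zs @ w # drop k zs)" if "length zs = k + total_excess ns" for zs w
    using that by (simp add: f_def k_def nth_append)
  have l: "length xs = k + total_excess ns" "length ys = k + total_excess ns"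
    using Cons.prems(2) mset_eq_length[OF Cons.prems(3)] by (simp_all add: k_def)
  have ms: "mset (take k zs @ w # drop k zs) = mset (w # zs)" for zs and w :: 'v
    by (metis append_take_drop_id mset_append mset.simps(2) union_mset_add_mset_right)
  show ?case
    unfolding cat[OF l(1)] cat[OF l(2)]
    by (rule adjacent_swaps_imp_permutation_invariant[where n = "Suc (k + total_excess ns)"])
      (use swap ms Cons.prems(3) l in auto)
qed simp

lemma caterpillar_permute_nodes:
  fixes g :: "'l \<Rightarrow> 'v"
  assumes "\<forall>n\<in>set ns. snd n \<noteq> 0" "length xs = total_excess ns" "mset ns = mset ms"
  shows "caterpillar g ns xs u = caterpillar g ms xs u"
proof -
  have swap: "caterpillar g (n # m # ns) xs u = caterpillar g (m # n # ns) xs u"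
    if ok: "\<forall>k\<in>set (n # m # ns). snd k \<noteq> 0" and l: "length xs = total_excess (n # m # ns)"
    for n m ns xs u
  proof -
    let ?X = "take (excess n) xs" and ?Y = "take (excess m) (drop (excess n) xs)"
      and ?Z = "drop (excess n + excess m) xs"
    have xs: "xs = ?X @ ?Y @ ?Z" by (metis append_take_drop_id drop_drop add.commute)
    have len: "length ?X = excess n" "length ?Y = excess m" using l by auto
    \<comment> \<open>Each vertex must keep its own block of leaves when the two trade places, so
      the leaf list is rearranged before the two operators are commuted.\<close>
    have "caterpillar g (m # n # ns) xs u = caterpillar g (m # n # ns) (?Y @ ?X @ ?Z) u"
    proof (rule caterpillar_permute_leaves)
      show "mset (u # xs) = mset (u # ?Y @ ?X @ ?Z)"
        by (subst xs) (simp add: ac_simps)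
    qed (use ok l in auto)
    also have "\<dots> = node_op g m ?Y (node_op g n ?X (caterpillar g ns ?Z u))"
      using len by simp
    also have "\<dots> = node_op g n ?X (node_op g m ?Y (caterpillar g ns ?Z u))"
      using ok by (intro commuting_apply_node_op commuting_node_op) auto
    also have "\<dots> = caterpillar g (n # m # ns) xs u" by (simp add: add.commute)
    finally show ?thesis by simp
  qed
  have swap': "caterpillar g (ks @ n # m # ns) xs u = caterpillar g (ks @ m # n # ns) xs u"
    if "\<forall>k\<in>set (ks @ n # m # ns). snd k \<noteq> 0" "length xs = total_excess (ks @ n # m # ns)"
    for ks n m ns xs u
    using that
  proof (induction ks arbitrary: xs)
    case Nil
    then show ?case using swap[of n m ns xs u] by (simp del: caterpillar.simps)
  qed auto
  \<comment> \<open>Swaps are justified only for rearrangements of \<open>ns\<close>; the default 0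
    makes the claim trivial for other lists.\<close>
  define f where "f ks = (if mset ks = mset ns then caterpillar g ks xs u else 0)" for ks
  have "f ns = f ms"
  proof (rule adjacent_swaps_imp_permutation_invariant)
    fix as bs and p q :: "('a, 'l) zvar" assume "length (as @ p # q # bs) = length ns"
    have "caterpillar g (as @ p # q # bs) xs u = caterpillar g (as @ q # p # bs) xs u"
      if eq: "mset (as @ p # q # bs) = mset ns"
    proof (rule swap')
      have "sum_list (map excess ns) = sum_list (map excess (as @ p # q # bs))"
        using eq by (metis mset_map sum_mset_sum_list)
      then show "length xs = total_excess (as @ p # q # bs)" using assms by simp
      have "set (as @ p # q # bs) = set ns" using eq by (metis set_mset_mset)
      then show "\<forall>k\<in>set (as @ p # q # bs). snd k \<noteq> 0" using assms by simp
    qed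
    then show "f (as @ p # q # bs) = f (as @ q # p # bs)" by (simp add: f_def add_mset_commute)
  qed (use assms in auto)
  then show ?thesis using assms by (simp add: f_def)
qed

section \<open>The span of caterpillars is closed under products\<close>

definition caterpillars :: "('l \<Rightarrow> 'v) \<Rightarrow> 'a set \<Rightarrow> 'l set \<Rightarrow> 'v set" where
  "caterpillars g A L = {caterpillar g ns (map g ls) (g l) | ns ls l.
    set ns \<subseteq> nodes A L \<and> length ls = total_excess ns \<and> set (l # ls) \<subseteq> L}"

lemma caterpillarsI:
  "set ns \<subseteq> nodes A L \<Longrightarrow> length ls = total_excess ns \<Longrightarrow> set (l # ls) \<subseteq> L \<Longrightarrow>
    caterpillar g ns (map g ls) (g l) \<in> caterpillars g A L"
  unfolding caterpillars_def by blast

lemma commuting_span: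
  assumes "commuting E" "\<And>x. x \<in> S \<Longrightarrow> E x \<in> span T" "x \<in> span S"
  shows "E x \<in> span T"
  using assms(3)
proof (induction rule: span_induct)
  case base
  have "E 0 = 0" using commuting_diff[OF assms(1), of 0 0] by simp
  then show ?case using assms(1) by (auto simp: subspace_def commuting_def span_zero span_add span_scale)
qed (rule assms(2))

lemma gen_in_span: "l \<in> L \<Longrightarrow> g l \<in> span (caterpillars g A L)"
  by (rule span_base) (force simp: caterpillars_def intro!: exI[of _ "[]"])

text \<open>If all children but one are generators, the vertex merely prolongs the spine at the
  top.\<close>

lemma node_op_in_span:
  assumes "n \<in> nodes A L" "set ls \<subseteq> L" "length ls = excess n" "x \<in> span (caterpillars g A L)"
  shows "node_op g n (map g ls) x \<in> span (caterpillars g A L)"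
proof (rule commuting_span[OF commuting_node_op _ assms(4)])
  fix x assume "x \<in> caterpillars g A L"
  then obtain ns ks l where x: "x = caterpillar g ns (map g ks) (g l)" "set ns \<subseteq> nodes A L"
      "length ks = total_excess ns" "set (l # ks) \<subseteq> L"
    by (auto simp: caterpillars_def)
  have "node_op g n (map g ls) x = caterpillar g (n # ns) (map g (ls @ ks)) (g l)"
    by (simp add: x assms)
  also have "\<dots> \<in> caterpillars g A L"
    by (rule caterpillarsI) (use x assms in auto)
  finally show "node_op g n (map g ls) x \<in> span (caterpillars g A L)" by (rule span_base)
qed (use assms in \<open>auto simp: nodes_def\<close>)

text \<open>A vertex with two children that are not generators would branch; sliding straightens it
  into one spine.\<close>

lemma node_op_in_span2:
  assumes n: "n \<in> nodes A L" and ls: "set ls \<subseteq> L" "len (snd n) = length ls + 2"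
    and x: "x \<in> span (caterpillars g A L)" and y: "y \<in> span (caterpillars g A L)"
  shows "node_op g n (x # map g ls) y \<in> span (caterpillars g A L)"
proof -
  have n0: "snd n \<noteq> 0" using n by (auto simp: nodes_def)
  have sym: "node_op g n (u # map g ls) v = node_op g n (v # map g ls) u" for u v
    using ls by (intro node_op_permute) auto
  have cats: "node_op g n (u # map g ls) v \<in> span (caterpillars g A L)"
    if "u \<in> caterpillars g A L" "v \<in> caterpillars g A L" for u v
  proof -
    obtain ns ks l where u: "u = caterpillar g ns (map g ks) (g l)" "set ns \<subseteq> nodes A L"
        "length ks = total_excess ns" "set (l # ks) \<subseteq> L"
      using \<open>u \<in> caterpillars g A L\<close> by (auto simp: caterpillars_def)
    obtain ns' ks' l' where v: "v = caterpillar g ns' (map g ks') (g l')" "set ns' \<subseteq> nodes A L"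
        "length ks' = total_excess ns'" "set (l' # ks') \<subseteq> L"
      using \<open>v \<in> caterpillars g A L\<close> by (auto simp: caterpillars_def)
    let ?E = "caterpillar g ns (map g ks)"
    have E: "commuting ?E" using u by (intro commuting_caterpillar) (auto simp: nodes_def)
    have "node_op g n (u # map g ls) v = node_op g n (v # map g ls) u" by (rule sym)
    \<comment> \<open>The inner vertices of \<open>u\<close> slide out above \<open>n\<close> and
      leave only the generator \<open>g l\<close> below it; \<open>v\<close> then continues the
      spine.\<close>
    also have "\<dots> = ?E (node_op g n (v # map g ls) (g l))"
      unfolding u(1) by (rule commuting_apply_node_op[OF E n0, symmetric])
    also have "\<dots> = ?E (node_op g n (map g (l # ls)) v)"
      by (simp add: sym)
    also have "\<dots> = caterpillar g (ns @ n # ns') (map g (ks @ (l # ls) @ ks')) (g l')"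
      using ls u(3) by (simp add: caterpillar_append v excess_def)
    also have "\<dots> \<in> caterpillars g A L"
      by (rule caterpillarsI) (use u v ls n in \<open>auto simp: excess_def\<close>)
    finally show ?thesis by (rule span_base)
  qed
  \<comment> \<open>Linearity is known for the spine argument, so \<open>y\<close> and then
    \<open>x\<close> are extended to the span by exchanging the two children.\<close>
  have "node_op g n (u # map g ls) y \<in> span (caterpillars g A L)" if "u \<in> caterpillars g A L" for u
    using commuting_span[OF commuting_node_op[OF n0] cats[OF that] y] .
  then have "node_op g n (y # map g ls) x \<in> span (caterpillars g A L)"
    by (intro commuting_span[OF commuting_node_op[OF n0] _ x]) (subst sym)
  then show ?thesis by (subst sym)
qed

text \<open>Together with the generators this makes the span a subalgebra. The induction runs down
  the spine of the right factor, with the Leibniz rule at its top vertex.\<close>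

lemma nov_in_span:
  assumes a: "a \<in> A" and x: "x \<in> span (caterpillars g A L)" and y: "y \<in> span (caterpillars g A L)"
  shows "x \<star>[a] y \<in> span (caterpillars g A L)"
proof -
  have base: "x \<star>[a] g l \<in> span (caterpillars g A L)" if "l \<in> L" for l
  proof -
    have "mset (list_of_pm (Poly_Mapping.single a 1)) = mset [a]"
      using mset_list_of_pm_add_single[of 0 a] length_list_of_pm[of "0 :: 'a \<Rightarrow>\<^sub>0 nat"]
      by (simp del: length_list_of_pm)
    then have "list_of_pm (Poly_Mapping.single a 1) = [a]" by (metis mset_single_iff_right)
    then have "x \<star>[a] g l = node_op g (l, Poly_Mapping.single a 1) (map g []) x"
      by (simp add: node_op_def polybrace_def)
    also have "\<dots> \<in> span (caterpillars g A L)"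
      by (rule node_op_in_span) (use a x that in \<open>auto simp: nodes_def excess_def fin_maps_def\<close>)
    finally show ?thesis .
  qed
  have cat: "x \<star>[a] caterpillar g ns (map g ls) (g l) \<in> span (caterpillars g A L)"
    if "set ns \<subseteq> nodes A L" "length ls = total_excess ns" "set (l # ls) \<subseteq> L" for ns ls l
    using that
  proof (induction ns arbitrary: ls)
    case Nil
    then show ?case using base by simp
  next
    case (Cons n ns)
    obtain m w where n: "n = (m, w)" by force
    define k where "k = excess n"
    have nn: "n \<in> nodes A L" and w: "len w = Suc k" "m \<in> L" "w \<in> fin_maps A"
      using Cons.prems(1) len_eq_0_iff[of w]
      by (auto simp: n nodes_def k_def excess_def simp del: len_eq_0_iff)
    define ks where "ks = take k ls"
    define v where "v = caterpillar g ns (map g (drop k ls)) (g l)"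
    have ks: "length ks = k" "set ks \<subseteq> L"
      using Cons.prems by (auto simp: ks_def k_def dest: in_set_takeD)
    have L: "set (l # drop k ls) \<subseteq> L" using Cons.prems by (auto dest: in_set_dropD)
    have l2: "length (drop k ls) = total_excess ns" using Cons.prems by (simp add: k_def)
    have v: "v \<in> span (caterpillars g A L)"
      unfolding v_def by (rule span_base, rule caterpillarsI) (use L l2 Cons.prems(1) in auto)
    have IH: "x \<star>[a] v \<in> span (caterpillars g A L)"
      unfolding v_def using Cons.prems(1) L l2 by (intro Cons.IH) auto
    have "caterpillar g (n # ns) (map g ls) (g l) = polybrace (list_of_pm w) (v # map g ks) (g m)"
      by (simp add: node_op_def v_def ks_def k_def n take_map drop_map)
    \<comment> \<open>\<open>x\<close> either becomes a new child of the top vertex, or multiplies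
      one of its leaves, or multiplies the rest \<open>v\<close> of the spine. The first two leave a
      vertex with two children that are not generators; the third falls under the induction
      hypothesis.\<close>
    then have "x \<star>[a] caterpillar g (n # ns) (map g ls) (g l)
        = polybrace (a # list_of_pm w) (x # v # map g ks) (g m)
          + ((\<Sum>i<k. polybrace (list_of_pm w) (v # (map g ks)[i := x \<star>[a] g (ks ! i)]) (g m))
          + polybrace (list_of_pm w) ((x \<star>[a] v) # map g ks) (g m))"
      using w ks by (simp add: nov_polybrace sum.lessThan_Suc_shift del: sum.lessThan_Suc)
    moreover have "polybrace (list_of_pm w) ((x \<star>[a] v) # map g ks) (g m) \<in> span (caterpillars g A L)"
      using node_op_in_span[OF nn ks(2) _ IH] ks by (simp add: node_op_def n k_def)
    moreover have "polybrace (a # list_of_pm w) (x # v # map g ks) (g m) \<in> span (caterpillars g A L)"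
    proof -
      have "polybrace (a # list_of_pm w) (x # v # map g ks) (g m)
          = node_op g (m, w + Poly_Mapping.single a 1) (v # map g ks) x"
        unfolding node_op_def fst_conv snd_conv
        by (rule polybrace_permute) (use mset_list_of_pm_add_single[of w a] w ks in auto)
      also have "\<dots> \<in> span (caterpillars g A L)"
      proof (rule node_op_in_span2)
        have "w + Poly_Mapping.single a 1 \<noteq> 0"
          by (metis len_add len_single len_zero add_is_0 zero_neq_one)
        then show "(m, w + Poly_Mapping.single a 1) \<in> nodes A L"
          using w a Poly_Mapping.keys_add[of w "Poly_Mapping.single a 1"]
          by (auto simp: nodes_def fin_maps_def)
      qed (use ks w v x in auto)
      finally show ?thesis .
    qed
    moreover have "polybrace (list_of_pm w) (v # (map g ks)[i := x \<star>[a] g (ks ! i)]) (g m) \<in> span (caterpillars g A L)"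
      if i: "i < k" for i
    proof -
      let ?r = "take i ks @ drop (Suc i) ks"
      have "polybrace (list_of_pm w) (v # (map g ks)[i := x \<star>[a] g (ks ! i)]) (g m)
          = node_op g n (v # map g ?r) (x \<star>[a] g (ks ! i))"
        unfolding node_op_def n fst_conv snd_conv
        by (rule polybrace_permute) (use i ks w in \<open>auto simp: upd_conv_take_nth_drop take_map drop_map\<close>)
      also have "\<dots> \<in> span (caterpillars g A L)"
      proof (rule node_op_in_span2[OF nn])
        show "x \<star>[a] g (ks ! i) \<in> span (caterpillars g A L)"
          using i ks by (intro base) (auto simp: subset_iff)
        show "set ?r \<subseteq> L" using ks by (auto dest: in_set_takeD in_set_dropD)
      qed (use i ks w v n in auto)
      finally show ?thesis .
    qed
    ultimately show ?case by (auto intro!: span_add span_sum)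
  qed
  show ?thesis
    using y
  proof (induction rule: span_induct)
    case base
    then show ?case by (auto simp: subspace_def nov_add_right nov_scale_right span_zero span_add span_scale)
  next
    case (step y)
    then show ?case using cat by (auto simp: caterpillars_def)
  qed
qed

end


section \<open>The derivations of the polynomial algebra\<close>

lemma poly_mapping_additive_induct [case_names zero single add]:
  assumes "P 0" "\<And>t c. P (Poly_Mapping.single t c)" "\<And>p q. P p \<Longrightarrow> P q \<Longrightarrow> P (p + q)"
  shows "P (p :: 'b \<Rightarrow>\<^sub>0 'k::ab_group_add)"
proof -
  have "p \<in> lin_combs UNIV" by (simp add: lin_combs_def)
  then show ?thesis by (induction rule: lin_combs_induct) (use assms in auto)
qed

lemma zpartial_superset:
  assumes "finite S" "Poly_Mapping.keys P \<subseteq> S"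
  shows "zpartial v P = (\<Sum>\<beta>\<in>S. Poly_Mapping.single (\<beta> - Poly_Mapping.single v 1)
      (of_nat (Poly_Mapping.lookup \<beta> v) * Poly_Mapping.lookup P \<beta>))"
  unfolding zpartial_def using assms
  by (intro sum.mono_neutral_left) (auto simp: in_keys_iff)

lemma zpartial_single:
  "zpartial v (Poly_Mapping.single \<beta> c)
    = Poly_Mapping.single (\<beta> - Poly_Mapping.single v 1) (of_nat (Poly_Mapping.lookup \<beta> v) * c)"
  by (subst zpartial_superset[of "{\<beta>}"]) auto

lemma zpartial_zero [simp]: "zpartial v 0 = 0"
  by (simp add: zpartial_def)

lemma zpartial_add: "zpartial v (P + Q) = zpartial v P + zpartial v Q"
proof -
  let ?S = "Poly_Mapping.keys P \<union> Poly_Mapping.keys Q"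
  show ?thesis
    by (subst (1 2 3) zpartial_superset[of ?S])
      (use Poly_Mapping.keys_add[of P Q] in \<open>auto simp: lookup_add distrib_left single_add sum.distrib\<close>)
qed

lemma zpartial_mult_single:
  "zpartial v (Poly_Mapping.single \<beta> c * Poly_Mapping.single \<gamma> d)
    = zpartial v (Poly_Mapping.single \<beta> c) * Poly_Mapping.single \<gamma> d
      + Poly_Mapping.single \<beta> c * zpartial v (Poly_Mapping.single \<gamma> d)"
proof -
  \<comment> \<open>Subtraction of exponents truncates; where it would, the coefficient
    \<open>lookup \<beta> v\<close> is 0 and the term vanishes.\<close>
  have e: "\<beta> - Poly_Mapping.single v 1 + \<gamma> = \<beta> + \<gamma> - Poly_Mapping.single v 1"
    if "Poly_Mapping.lookup \<beta> v \<noteq> 0" for \<beta> \<gamma> :: "('b, 'a) multi_index"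
    by (rule poly_mapping_eqI) (use that in \<open>auto simp: lookup_add lookup_minus lookup_single when_def\<close>)
  have "Poly_Mapping.single (\<beta> - Poly_Mapping.single v 1 + \<gamma>) (of_nat (Poly_Mapping.lookup \<beta> v) * c * d)
      = Poly_Mapping.single (\<beta> + \<gamma> - Poly_Mapping.single v 1) (of_nat (Poly_Mapping.lookup \<beta> v) * c * d)"
    using e by (cases "Poly_Mapping.lookup \<beta> v = 0") auto
  moreover have "Poly_Mapping.single (\<beta> + (\<gamma> - Poly_Mapping.single v 1)) (c * (of_nat (Poly_Mapping.lookup \<gamma> v) * d))
      = Poly_Mapping.single (\<beta> + \<gamma> - Poly_Mapping.single v 1) (of_nat (Poly_Mapping.lookup \<gamma> v) * c * d)"
    using e[of \<gamma> \<beta>] by (cases "Poly_Mapping.lookup \<gamma> v = 0") (auto simp: ac_simps)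
  ultimately show ?thesis
    by (simp add: zpartial_single mult_single lookup_add single_add[symmetric] algebra_simps)
qed

lemma zpartial_mult: "zpartial v (P * Q) = zpartial v P * Q + P * zpartial v Q"
proof (induction P rule: poly_mapping_additive_induct)
  case (single \<beta> c)
  show ?case
    by (induction Q rule: poly_mapping_additive_induct)
      (simp_all add: zpartial_mult_single zpartial_add distrib_left add_ac)
qed (simp_all add: zpartial_add distrib_right add_ac)

lemma zpartial_zvar: "zpartial v (zvar u) = (if v = u then 1 else 0)"
  by (auto simp: zvar_def zpartial_single lookup_single)

text \<open>\<open>Sum_any\<close> is 0 by default on infinite support, so additivity and the
  product rule of \<open>zD\<close> depend on this finiteness.\<close>

lemma finite_zpartial_nonzero: "finite {v. zpartial v P \<noteq> 0}"
proof (rule finite_subset)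
  show "{v. zpartial v P \<noteq> 0} \<subseteq> (\<Union>\<beta>\<in>Poly_Mapping.keys P. Poly_Mapping.keys \<beta>)"
  proof clarify
    fix v assume "zpartial v P \<noteq> 0"
    then obtain \<beta> where \<beta>: "\<beta> \<in> Poly_Mapping.keys P" "Poly_Mapping.single (\<beta> - Poly_Mapping.single v 1)
      (of_nat (Poly_Mapping.lookup \<beta> v) * Poly_Mapping.lookup P \<beta>) \<noteq> 0"
      unfolding zpartial_def by (meson sum.not_neutral_contains_not_neutral)
    then have "Poly_Mapping.lookup \<beta> v \<noteq> 0" by (intro notI) simp
    then show "v \<in> (\<Union>\<beta>\<in>Poly_Mapping.keys P. Poly_Mapping.keys \<beta>)"
      using \<beta>(1) by (auto simp: in_keys_iff)
  qed
qed simp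

section \<open>The derivations \<open>zD n\<close>\<close>

definition zD_coeff :: "'a \<Rightarrow> ('a, 'l) zvar \<Rightarrow> ('a, 'l, 'k::field_char_0) zpoly" where
  "zD_coeff n v = of_nat (Poly_Mapping.lookup (snd v) n + 1)
    * zvar (fst v, snd v + Poly_Mapping.single n 1)"

lemma zD_eq: "zD n P = Sum_any (\<lambda>v. zD_coeff n v * zpartial v P)"
  by (simp add: zD_def zD_coeff_def case_prod_beta')

lemma finite_zD_coeff: "finite {v. zD_coeff n v * zpartial v P \<noteq> 0}"
  by (rule finite_subset[OF _ finite_zpartial_nonzero[of P]]) auto

lemma zD_add: "zD n (P + Q) = zD n P + zD n Q"
  by (simp add: zD_eq zpartial_add distrib_left Sum_any.distrib finite_zD_coeff)

lemma zD_mult: "zD n (P * Q) = zD n P * Q + P * zD n Q"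
proof -
  have "zD n (P * Q) = Sum_any (\<lambda>v. zD_coeff n v * zpartial v P * Q + P * (zD_coeff n v * zpartial v Q))"
    by (simp add: zD_eq zpartial_mult algebra_simps)
  also have "\<dots> = Sum_any (\<lambda>v. zD_coeff n v * zpartial v P * Q)
      + Sum_any (\<lambda>v. P * (zD_coeff n v * zpartial v Q))"
    by (rule Sum_any.distrib)
      (auto intro: finite_subset[OF _ finite_zD_coeff[of n P]] finite_subset[OF _ finite_zD_coeff[of n Q]])
  also have "\<dots> = zD n P * Q + P * zD n Q"
    by (simp add: zD_eq Sum_any_left_distrib Sum_any_right_distrib finite_zD_coeff)
  finally show ?thesis .
qed

lemma zD_zvar: "zD n (zvar v) = zD_coeff n v"
  unfolding zD_eq by (subst Sum_any.expand_superset[of "{v}"]) (auto simp: zpartial_zvar)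

lemma zD_const [simp]: "zD n (Poly_Mapping.single 0 c) = 0"
  by (simp add: zD_eq zpartial_single)

lemma zD_of_nat [simp]: "zD n (of_nat m) = 0"
  by (metis single_of_nat zD_const)

lemma zD_one [simp]: "zD n 1 = 0"
  using zD_of_nat[of n 1] by simp

lemma zD_of_nat_mult [simp]: "zD n (of_nat m * P) = of_nat m * zD n P"
  by (simp add: zD_mult)

lemma zD_zero [simp]: "zD n 0 = 0"
  by (simp add: zD_eq)

text \<open>Suited to derivations, which are determined by their values on the variables.\<close>

lemma zpoly_induct [case_names const zvar add mult]:
  fixes p :: "('a, 'l, 'k::field_char_0) zpoly"
  assumes "\<And>c. P (Poly_Mapping.single 0 c)" "\<And>v. P (zvar v)"
    and "\<And>p q. P p \<Longrightarrow> P q \<Longrightarrow> P (p + q)" "\<And>p q. P p \<Longrightarrow> P q \<Longrightarrow> P (p * q)"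
  shows "P p"
proof (induction p rule: poly_mapping_additive_induct)
  case (single \<beta> c)
  have "P (Poly_Mapping.single (pm_of_list vs) c)" for vs
  proof (induction vs)
    case (Cons v vs)
    have "Poly_Mapping.single (pm_of_list (v # vs)) c = zvar v * Poly_Mapping.single (pm_of_list vs) c"
      by (simp add: zvar_def mult_single)
    then show ?case using Cons assms by metis
  qed (simp add: assms)
  then show ?case by (metis pm_of_list_surj)
qed (use assms(1)[of 0] assms(3) in auto)

lemma zD_coeff_commute:
  "zD a (zD_coeff b v) = zD b (zD_coeff a v :: ('a, 'l, 'k::field_char_0) zpoly)"
proof -
  obtain l w where v: "v = (l, w)" by force
  have "of_nat (Poly_Mapping.lookup w b + 1) * of_nat (Poly_Mapping.lookup (w + Poly_Mapping.single b 1) a + 1)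
      = of_nat (Poly_Mapping.lookup w a + 1)
        * (of_nat (Poly_Mapping.lookup (w + Poly_Mapping.single a 1) b + 1) :: ('a, 'l, 'k) zpoly)"
    by (cases "a = b") (auto simp: lookup_add lookup_single algebra_simps)
  moreover have "w + Poly_Mapping.single b 1 + Poly_Mapping.single a 1
      = w + Poly_Mapping.single a 1 + Poly_Mapping.single b 1"
    by (simp add: ac_simps)
  moreover have "zD a (zD_coeff b v :: ('a, 'l, 'k) zpoly)
      = of_nat (Poly_Mapping.lookup w b + 1) * of_nat (Poly_Mapping.lookup (w + Poly_Mapping.single b 1) a + 1)
        * zvar (l, w + Poly_Mapping.single b 1 + Poly_Mapping.single a 1)" for a b
    by (simp only: v zD_coeff_def fst_conv snd_conv zD_of_nat_mult zD_zvar mult.assoc)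
  ultimately show ?thesis by metis
qed

text \<open>Both composites obey the same second order product rule, so it is enough to compare them
  on variables. This is what identity (2) requires.\<close>

lemma zD_commute: "zD a (zD b P) = zD b (zD a P)"
  by (induction P rule: zpoly_induct)
    (simp_all add: zD_zvar zD_coeff_commute[of a b] zD_add zD_mult algebra_simps)

lemma zD_smult: "zD a (pm_smult c P) = pm_smult c (zD a P)"
  by (simp add: pm_smult_def mult_map_scale_conv_mult zD_mult)

lemma pm_smult_mult_left: "pm_smult c P * Q = pm_smult c (P * Q)"
  for P Q :: "('a, 'l, 'k::field_char_0) zpoly"
  by (simp add: pm_smult_def mult_map_scale_conv_mult mult.assoc)

lemma pm_smult_mult_right: "P * pm_smult c Q = pm_smult c (P * Q)"
  for P Q :: "('a, 'l, 'k::field_char_0) zpoly"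
  by (simp add: pm_smult_def mult_map_scale_conv_mult mult.left_commute)

text \<open>The Leibniz rule in the shape of the corrections in \<open>brace\<close>: one list
  update per factor.\<close>

lemma mult_zD_prod_list:
  "P * zD a (prod_list Qs) = (\<Sum>i<length Qs. prod_list (Qs[i := P * zD a (Qs ! i)]))"
proof (induction Qs)
  case Nil
  then show ?case by simp
next
  case (Cons Q Qs)
  have "P * zD a (prod_list (Q # Qs)) = P * zD a Q * prod_list Qs + Q * (P * zD a (prod_list Qs))"
    by (simp add: zD_mult algebra_simps)
  then show ?case
    by (simp add: Cons.IH sum_distrib_left sum.lessThan_Suc_shift del: sum.lessThan_Suc)
qed

text \<open>For \<open>w = 0\<close> the constant \<open>k\<close> is the product of the factorials
  of the multiplicities in \<open>as\<close>. Only its positivity matters: in characteristic zero it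
  is invertible.\<close>

lemma foldr_zD_zvar:
  "\<exists>k>0. foldr zD as (zvar (l, w)) = of_nat k * (zvar (l, w + pm_of_list as) :: ('a, 'l, 'k::field_char_0) zpoly)"
proof (induction as)
  case Nil
  then show ?case by (intro exI[of _ 1]) simp
next
  case (Cons a as)
  then obtain k where k: "k > 0" "foldr zD as (zvar (l, w))
      = of_nat k * (zvar (l, w + pm_of_list as) :: ('a, 'l, 'k) zpoly)" by blast
  let ?m = "Poly_Mapping.lookup (w + pm_of_list as) a + 1"
  have "foldr zD (a # as) (zvar (l, w))
      = of_nat (k * ?m) * (zvar (l, w + pm_of_list (a # as)) :: ('a, 'l, 'k) zpoly)"
    by (simp add: k zD_zvar zD_coeff_def algebra_simps)
  moreover have "k * ?m > 0" using k by simp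
  ultimately show ?case by blast
qed

section \<open>The grading behind the populated condition\<close>

definition weight :: "('a, 'l) multi_index \<Rightarrow> int" where
  "weight \<beta> = (\<Sum>v\<in>Poly_Mapping.keys \<beta>. (1 - int (len (snd v))) * int (Poly_Mapping.lookup \<beta> v))"

lemma populated_iff: "populated \<beta> \<longleftrightarrow> weight \<beta> = 1"
  by (simp add: populated_def weight_def case_prod_beta')

lemma weight_add: "weight (\<beta> + \<gamma>) = weight \<beta> + weight \<gamma>"
proof -
  let ?S = "Poly_Mapping.keys \<beta> \<union> Poly_Mapping.keys \<gamma>"
  have w: "weight \<delta> = (\<Sum>v\<in>?S. (1 - int (len (snd v))) * int (Poly_Mapping.lookup \<delta> v))"
    if "Poly_Mapping.keys \<delta> \<subseteq> ?S" for \<delta>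
    unfolding weight_def using that by (intro sum.mono_neutral_left) (auto simp: in_keys_iff)
  show ?thesis
    using Poly_Mapping.keys_add[of \<beta> \<gamma>]
    by (simp add: w lookup_add distrib_left sum.distrib)
qed

lemma weight_single [simp]:
  "weight (Poly_Mapping.single v 1) = 1 - int (len (snd v))"
  "weight (Poly_Mapping.single v (Suc 0)) = 1 - int (len (snd v))"
  by (simp_all add: weight_def)

lemma weight_zero [simp]: "weight 0 = 0"
  by (simp add: weight_def)

text \<open>\<open>zD a\<close> lowers the degree by one, so \<open>P * zD a Q\<close> has degree
  \<open>1 + (1 - 1) = 1\<close> whenever \<open>P\<close> and \<open>Q\<close> have degree
  1.\<close>

definition homogeneous :: "'a set \<Rightarrow> 'l set \<Rightarrow> int \<Rightarrow> ('a, 'l, 'k::field_char_0) zpoly set" where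
  "homogeneous A L m = lin_combs {\<beta> \<in> gen_multi_indices A L. weight \<beta> = m}"

lemma gen_multi_indices_add:
  "\<beta> \<in> gen_multi_indices A L \<Longrightarrow> \<gamma> \<in> gen_multi_indices A L \<Longrightarrow> \<beta> + \<gamma> \<in> gen_multi_indices A L"
  using Poly_Mapping.keys_add[of \<beta> \<gamma>] by (auto simp: gen_multi_indices_def fin_maps_def)

lemma homogeneous_mult:
  assumes "P \<in> homogeneous A L m" "Q \<in> homogeneous A L n"
  shows "P * Q \<in> homogeneous A L (m + n)"
  unfolding homogeneous_def lin_combs_def
proof clarify
  fix x assume "x \<in> Poly_Mapping.keys (P * Q)"
  then obtain \<beta> \<gamma> where "x = \<beta> + \<gamma>" "\<beta> \<in> Poly_Mapping.keys P" "\<gamma> \<in> Poly_Mapping.keys Q"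
    using keys_mult[of P Q] by blast
  then show "x \<in> gen_multi_indices A L \<and> weight x = m + n"
    using assms by (auto simp: homogeneous_def lin_combs_def weight_add intro: gen_multi_indices_add)
qed

lemma homogeneous_zvar:
  "v \<in> L \<times> fin_maps A \<Longrightarrow> zvar v \<in> homogeneous A L (1 - int (len (snd v)))"
  unfolding homogeneous_def zvar_def
  by (rule lin_combs_single) (auto simp: gen_multi_indices_def fin_maps_def)

lemma homogeneous_add: "P \<in> homogeneous A L m \<Longrightarrow> Q \<in> homogeneous A L m \<Longrightarrow> P + Q \<in> homogeneous A L m"
  by (simp add: homogeneous_def lin_combs_add)

lemma homogeneous_zD:
  fixes P :: "('a, 'l, 'k::field_char_0) zpoly"
  assumes a: "a \<in> A" and P: "P \<in> homogeneous A L m"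
  shows "zD a P \<in> homogeneous A L (m - 1)"
  using P unfolding homogeneous_def[of A L m]
proof (induction rule: lin_combs_induct)
  case (single \<beta> c)
  \<comment> \<open>Writing the monomial as a list of variables lets the product rule split off one
    variable at a time.\<close>
  have "zD a (Poly_Mapping.single (pm_of_list vs) c :: ('a, 'l, 'k) zpoly)
      \<in> homogeneous A L (weight (pm_of_list vs) - 1)"
    if "set vs \<subseteq> L \<times> fin_maps A" for vs
    using that
  proof (induction vs)
    case (Cons v vs)
    have e: "Poly_Mapping.single (pm_of_list (v # vs)) c = zvar v * Poly_Mapping.single (pm_of_list vs) c"
      by (simp add: zvar_def mult_single)
    have 1: "zvar v \<in> homogeneous A L (1 - int (len (snd v)))"
      using Cons.prems by (intro homogeneous_zvar) auto
    have 2: "Poly_Mapping.single (pm_of_list vs) c \<in> homogeneous A L (weight (pm_of_list vs))"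
      unfolding homogeneous_def using Cons.prems
      by (intro lin_combs_single) (auto simp: gen_multi_indices_def fin_maps_def)
    have "(fst v, snd v + Poly_Mapping.single a 1) \<in> L \<times> fin_maps A"
      using a Cons.prems Poly_Mapping.keys_add[of "snd v" "Poly_Mapping.single a 1"]
      by (force simp: fin_maps_def)
    from homogeneous_zvar[OF this]
    have "(zvar (fst v, snd v + Poly_Mapping.single a 1) :: ('a, 'l, 'k) zpoly) \<in> homogeneous A L (- int (len (snd v)))"
      by simp
    then have 3: "(zD a (zvar v) :: ('a, 'l, 'k) zpoly) \<in> homogeneous A L (- int (len (snd v)))"
      unfolding zD_zvar zD_coeff_def single_of_nat[symmetric] mult_map_scale_conv_mult[symmetric]
        pm_smult_def[symmetric]
      by (simp add: homogeneous_def lin_combs_smult)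
    show ?case
      unfolding e zD_mult using homogeneous_mult[OF 3 2] homogeneous_mult[OF 1 Cons.IH] Cons.prems
      by (intro homogeneous_add) (auto simp: weight_add algebra_simps)
  qed (simp add: homogeneous_def)
  from this[of "list_of_pm \<beta>"] show ?case
    using single by (auto simp: gen_multi_indices_def fin_maps_def)
qed (simp_all add: homogeneous_def zD_add lin_combs_add)

section \<open>Populated multi-indices form a multi-Novikov algebra\<close>

lemma M_gen_simps:
  "carrier (M_gen d L) = homogeneous (Nd d) L 1" "\<zero>\<^bsub>M_gen d L\<^esub> = 0"
  "x \<oplus>\<^bsub>M_gen d L\<^esub> y = x + y" "c \<odot>\<^bsub>M_gen d L\<^esub> x = pm_smult c x"
  "x \<triangleright>[n]\<^bsub>M_gen d L\<^esub> y = x * zD n y"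
  by (simp_all add: M_gen_def homogeneous_def populated_iff)

lemma M_gen_abelian_group: "abelian_group (M_gen d L :: ('k::field_char_0, _, (_, 'l, 'k) zpoly) nov_algebra)"
proof (rule abelian_groupI)
  fix x :: "(nat \<Rightarrow> nat, 'l, 'k) zpoly" assume "x \<in> carrier (M_gen d L)"
  then show "\<exists>y\<in>carrier (M_gen d L). y \<oplus>\<^bsub>M_gen d L\<^esub> x = \<zero>\<^bsub>M_gen d L\<^esub>"
    by (intro bexI[of _ "- x"]) (auto simp: M_gen_simps homogeneous_def lin_combs_uminus)
qed (auto simp: M_gen_simps homogeneous_def lin_combs_add algebra_simps)

lemma M_gen_minus:
  fixes x y :: "(nat \<Rightarrow> nat, 'l, 'k::field_char_0) zpoly"
  assumes "x \<in> homogeneous (Nd d) L 1" "y \<in> homogeneous (Nd d) L 1"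
  shows "x \<ominus>\<^bsub>M_gen d L\<^esub> y = x - y"
proof -
  interpret abelian_group "M_gen d L :: ('k, _, (_, 'l, 'k) zpoly) nov_algebra"
    by (rule M_gen_abelian_group)
  have "\<ominus>\<^bsub>M_gen d L\<^esub> y = - y"
    by (rule minus_equality) (use assms in \<open>auto simp: M_gen_simps homogeneous_def lin_combs_uminus\<close>)
  then show ?thesis by (simp add: a_minus_def M_gen_simps)
qed

lemma homogeneous_nprod:
  "a \<in> A \<Longrightarrow> P \<in> homogeneous A L 1 \<Longrightarrow> Q \<in> homogeneous A L 1 \<Longrightarrow> P * zD a Q \<in> homogeneous A L 1"
  using homogeneous_mult[OF _ homogeneous_zD, of P A L 1 a Q 1] by simp

text \<open>The associator in (1) and (2) is \<open>- (x * y * zD a (zD b z))\<close>, symmetric in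
  \<open>x\<close>, \<open>y\<close> and, as derivations commute, in \<open>a\<close>,
  \<open>b\<close>. Identity (3) is commutativity of multiplication.\<close>

lemma M_gen_multi_novikov:
  "multi_novikov_algebra (Nd d) (M_gen d L :: ('k::field_char_0, _, (_, 'l, 'k) zpoly) nov_algebra)"
proof (intro multi_novikov_algebra.intro multi_novikov_algebra_axioms.intro)
  show "Module.module (ring_of_type_algebra :: 'k ring) (M_gen d L :: ('k, _, (_, 'l, 'k) zpoly) nov_algebra)"
    by (rule moduleI)
      (auto simp: cring_from_type_algebra M_gen_abelian_group M_gen_simps homogeneous_def
        lin_combs_smult pm_smult_simps)
qed (simp_all add: M_gen_simps homogeneous_nprod M_gen_minus,
    simp_all add: zD_add zD_mult zD_smult zD_commute pm_smult_mult_left pm_smult_mult_right algebra_simps)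


section \<open>Evaluation of caterpillars\<close>

lemma vector_space_pm_smult: "vector_space (pm_smult :: 'k::field \<Rightarrow> ('b \<Rightarrow>\<^sub>0 'k) \<Rightarrow> _)"
  by unfold_locales (simp_all add: pm_smult_simps)

text \<open>Realises the quotient of \<open>W\<close> by \<open>J\<close> as a complement of
  \<open>J\<close> inside \<open>W\<close>, with a projection defined on the whole space.\<close>

lemma (in vector_space) ex_projection_mod_subspace:
  assumes J: "subspace J" and W: "subspace W" and "J \<subseteq> W"
  shows "\<exists>\<pi>. Vector_Spaces.linear scale scale \<pi> \<and> range \<pi> \<subseteq> W \<and> (\<forall>x\<in>W. \<pi> x - x \<in> J) \<and> (\<forall>x\<in>J. \<pi> x = 0)"
proof -
  interpret pair: vector_space_pair scale scale ..
  obtain B where B: "B \<subseteq> J" "independent B" "J \<subseteq> span B"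
    using maximal_independent_subset[of J] by metis
  obtain B1 where B1: "B \<subseteq> B1" "B1 \<subseteq> W" "independent B1" "W \<subseteq> span B1"
    using maximal_independent_subset_extend[of B W] B \<open>J \<subseteq> W\<close> by (metis order_trans)
  \<comment> \<open>\<open>B\<close> is a basis of \<open>J\<close>, extended to a basis
    \<open>B1\<close> of \<open>W\<close> and then to one of the whole space; \<open>\<pi>\<close>
    fixes \<open>B1 - B\<close> and kills all other basis vectors.\<close>
  obtain \<pi> where lin: "Vector_Spaces.linear scale scale \<pi>"
      and \<pi>: "\<forall>x\<in>extend_basis B1. \<pi> x = (if x \<in> B1 - B then x else 0)"
    using pair.linear_independent_extend[OF independent_extend_basis[OF B1(3)],
        of "\<lambda>x. if x \<in> B1 - B then x else 0"] by blast
  interpret Vector_Spaces.linear scale scale \<pi> by fact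
  have sup: "B1 \<subseteq> extend_basis B1" by (rule extend_basis_superset[OF B1(3)])
  have W_mem: "\<pi> x \<in> W" for x
  proof -
    have "x \<in> span (extend_basis B1)" using B1(3) by simp
    then show ?thesis
      by (induction rule: span_induct)
        (use \<pi> B1(2) W in \<open>auto simp: subspace_def add scale\<close>)
  qed
  have "\<pi> x - x \<in> J" if "x \<in> W" for x
  proof -
    have "x \<in> span B1" using that B1 by blast
    then show ?thesis
    proof (induction rule: span_induct)
      case base
      have e1: "\<pi> (x + y) - (x + y) = (\<pi> x - x) + (\<pi> y - y)" for x y by (simp add: add)
      have e2: "\<pi> (scale c x) - scale c x = scale c (\<pi> x - x)" for c x
        by (simp add: scale scale_right_diff_distrib)
      have e3: "\<pi> 0 - 0 = 0" by (simp add: zero)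
      show ?case using J unfolding subspace_def mem_Collect_eq e1 e2 e3 by blast
    next
      case (step x)
      show ?case
      proof (cases "x \<in> B")
        case True
        then have "\<pi> x = 0" using \<pi> sup B1(1) by auto
        then show ?thesis using subspace_neg[OF J, of x] True B(1) by auto
      next
        case False
        then have "\<pi> x = x" using \<pi> sup step by auto
        then show ?thesis using subspace_0[OF J] by simp
      qed
    qed
  qed
  moreover have "\<pi> x = 0" if "x \<in> J" for x
  proof -
    have "x \<in> span B" using that B by blast
    then show ?thesis
      by (induction rule: span_induct) (use \<pi> sup B1(1) in \<open>auto simp: subspace_def add scale\<close>)
  qed
  ultimately show ?thesis using lin W_mem by blast
qed

lemma prod_list_zvar: "prod_list (map zvar vs) = Poly_Mapping.single (pm_of_list vs) 1"
  by (induction vs) (simp_all add: zvar_def mult_single)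

text \<open>The coefficient of \<open>F x\<close> at the monomial \<open>b c\<close> isolates the
  coefficient of \<open>c\<close> in \<open>x\<close>; independence of \<open>C\<close> is a
  consequence and not a hypothesis.\<close>

lemma (in vector_space) inj_on_span_if_monomial:
  fixes F :: "'b \<Rightarrow> ('c \<Rightarrow>\<^sub>0 'a)"
  assumes F_add: "\<And>x y. F (x + y) = F x + F y" and F_scale: "\<And>c x. F (scale c x) = pm_smult c (F x)"
    and mono: "\<And>x. x \<in> C \<Longrightarrow> F x = Poly_Mapping.single (b x) (r x)" "\<And>x. x \<in> C \<Longrightarrow> r x \<noteq> 0"
    and inj: "inj_on b C" and x: "x \<in> span C" "F x = 0"
  shows "x = 0"
proof -
  obtain S u where S: "finite S" "S \<subseteq> C" "x = (\<Sum>c\<in>S. scale (u c) c)"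
    using x(1) unfolding span_explicit by blast
  have F0: "F 0 = 0" using F_add[of 0 0] by simp
  have F_sum: "F (\<Sum>c\<in>T. f c) = (\<Sum>c\<in>T. F (f c))" for T and f :: "'b \<Rightarrow> 'b"
    by (induction T rule: infinite_finite_induct) (simp_all add: F0 F_add)
  have "u c = 0" if c: "c \<in> S" for c
  proof -
    have "0 = Poly_Mapping.lookup (F x) (b c)" using x(2) by simp
    also have "\<dots> = (\<Sum>d\<in>S. Poly_Mapping.lookup (pm_smult (u d) (F d)) (b c))"
      by (simp only: S(3) F_sum F_scale lookup_sum)
    also have "\<dots> = (\<Sum>d\<in>S. if d = c then u c * r c else 0)"
      using c S(2) inj by (intro sum.cong refl) (auto simp: mono lookup_single when_def inj_on_def subset_iff)
    also have "\<dots> = u c * r c" using c S(1) by simp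
    finally show ?thesis using mono(2) c S(2) by auto
  qed
  then show ?thesis by (simp add: S(3))
qed

section \<open>Images of braces and caterpillars in the polynomial algebra\<close>

context total_multi_novikov
begin

context
  fixes A :: "'a set" and F :: "'v \<Rightarrow> ('a, 'l, 'k) zpoly"
  assumes F_add: "F (x + y) = F x + F y"
    and F_nov: "a \<in> A \<Longrightarrow> F (x \<star>[a] y) = F x * zD a (F y)"
begin

text \<open>The corrections subtracted in \<open>brace\<close> are exactly the Leibniz terms in
  which a derivation hits one of the other arguments, so all derivations end up on
  \<open>y\<close>.\<close>

lemma eval_brace:
  "fst ` set ps \<subseteq> A \<Longrightarrow> F (brace ps y) = prod_list (map (F \<circ> snd) ps) * foldr zD (map fst ps) (F y)"
proof (induction "length ps" arbitrary: ps)
  case (Suc n)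
  then obtain a x qs where ps: "ps = (a, x) # qs" by (metis length_Suc_conv surj_pair)
  have a: "a \<in> A" and qs: "fst ` set qs \<subseteq> A" "n = length qs" using Suc ps by auto
  have F_diff: "F (u - v) = F u - F v" for u v
    using F_add[of "u - v" v] by (simp add: algebra_simps)
  have F_sum: "F (\<Sum>i\<in>I. f i) = (\<Sum>i\<in>I. F (f i))" for I and f :: "nat \<Rightarrow> 'v"
  proof -
    have "F 0 = 0" using F_diff[of 0 0] by simp
    then show ?thesis by (induction I rule: infinite_finite_induct) (simp_all add: F_add)
  qed
  let ?P = "map (F \<circ> snd) qs" and ?D = "foldr zD (map fst qs) (F y)"
  have "F (brace (qs[i := upd a x (qs ! i)]) y) = prod_list (?P[i := F x * zD a (?P ! i)]) * ?D"
    if i: "i < length qs" for i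
  proof -
    have fst: "map fst (qs[i := upd a x (qs ! i)]) = map fst qs"
      using i by (simp add: list_eq_iff_nth_eq nth_list_update upd_def)
    have "fst ` set (qs[i := upd a x (qs ! i)]) \<subseteq> A"
      using qs(1) fst by (metis list.set_map)
    then have "F (brace (qs[i := upd a x (qs ! i)]) y)
        = prod_list (map (F \<circ> snd) (qs[i := upd a x (qs ! i)]))
          * foldr zD (map fst (qs[i := upd a x (qs ! i)])) (F y)"
      by (rule Suc(1)[rotated]) (simp only: qs(2) length_list_update)
    moreover have "map (F \<circ> snd) (qs[i := upd a x (qs ! i)]) = ?P[i := F x * zD a (?P ! i)]"
      using i a by (simp add: map_update upd_def F_nov)
    ultimately show ?thesis by (simp only: fst)
  qed
  then have "F (brace ps y) = F x * zD a (prod_list ?P * ?D)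
      - (\<Sum>i<length qs. prod_list (?P[i := F x * zD a (?P ! i)]) * ?D)"
    using Suc(1)[of qs] qs a by (simp add: ps F_diff F_sum F_nov)
  \<comment> \<open>The corrections add up to the part of the product rule where \<open>zD a\<close>
    hits \<open>prod_list ?P\<close>.\<close>
  also have "\<dots> = F x * zD a (prod_list ?P * ?D) - F x * zD a (prod_list ?P) * ?D"
    by (simp only: mult_zD_prod_list sum_distrib_right length_map)
  finally show ?case by (simp add: ps zD_mult algebra_simps)
qed simp

lemma eval_polybrace:
  assumes "set as \<subseteq> A" "length as = length xs"
  shows "F (polybrace as xs y) = prod_list (map F xs) * foldr zD as (F y)"
proof -
  have "map (F \<circ> snd) (zip as xs) = map F xs" "map fst (zip as xs) = as"
    using assms(2) by (simp_all flip: map_map)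
  moreover have "fst ` set (zip as xs) \<subseteq> A" using assms by (auto dest: set_zip_leftD)
  ultimately show ?thesis by (simp add: polybrace_def eval_brace)
qed

context
  fixes g :: "'l \<Rightarrow> 'v" and L :: "'l set"
  assumes F_g: "l \<in> L \<Longrightarrow> F (g l) = zvar (l, 0)"
begin

lemma eval_node_op:
  assumes "n \<in> nodes A L" "len (snd n) = Suc (length xs)"
  shows "\<exists>k>0. F (node_op g n xs u) = of_nat k * zvar n * prod_list (map F xs) * F u"
proof -
  obtain l w where n: "n = (l, w)" by force
  have lw: "l \<in> L" "Poly_Mapping.keys w \<subseteq> A" using assms by (auto simp: n nodes_def fin_maps_def)
  obtain k where k: "k > 0" "foldr zD (list_of_pm w) (zvar (l, 0)) = of_nat k * (zvar (l, w) :: ('a, 'l, 'k) zpoly)"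
    using foldr_zD_zvar[of "list_of_pm w" l 0] by auto
  have "F (node_op g n xs u) = of_nat k * zvar n * prod_list (map F xs) * F u"
    using assms(2) lw k(2) by (simp add: node_op_def n eval_polybrace F_g algebra_simps)
  then show ?thesis using k(1) by blast
qed

lemma eval_caterpillar:
  assumes "set ns \<subseteq> nodes A L" "length xs = total_excess ns"
  shows "\<exists>k>0. F (caterpillar g ns xs u) = of_nat k * prod_list (map zvar ns) * prod_list (map F xs) * F u"
  using assms
proof (induction ns arbitrary: xs)
  case Nil
  then show ?case by (intro exI[of _ 1]) simp
next
  case (Cons n ns)
  let ?m = "excess n"
  have "snd n \<noteq> 0" using Cons.prems by (auto simp: nodes_def)
  then have "len (snd n) = Suc (length (take ?m xs))"
    using Cons.prems len_eq_0_iff[of "snd n"] by (simp add: excess_def del: len_eq_0_iff)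
  then obtain k where k: "k > 0" "F (node_op g n (take ?m xs) (caterpillar g ns (drop ?m xs) u))
      = of_nat k * zvar n * prod_list (map F (take ?m xs)) * F (caterpillar g ns (drop ?m xs) u)"
    using eval_node_op Cons.prems(1) by (metis insert_subset list.simps(15))
  obtain j where j: "j > 0" "F (caterpillar g ns (drop ?m xs) u)
      = of_nat j * prod_list (map zvar ns) * prod_list (map F (drop ?m xs)) * F u"
    using Cons.IH[of "drop ?m xs"] Cons.prems by auto
  have "prod_list (map F xs) = prod_list (map F (take ?m xs)) * prod_list (map F (drop ?m xs))"
    by (metis append_take_drop_id map_append prod_list.append)
  then have "F (caterpillar g (n # ns) xs u)
      = of_nat (k * j) * prod_list (map zvar (n # ns)) * prod_list (map F xs) * F u"
    by (simp add: k(2) j(2) algebra_simps)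
  then show ?case using k(1) j(1) by (metis nat_0_less_mult_iff)
qed

text \<open>Every vertex contributes its own variable, so the monomial records the multiset of
  vertices, with the leaves as \<open>(l, 0)\<close>.\<close>

lemma eval_caterpillar_gens:
  assumes "set ns \<subseteq> nodes A L" "length ls = total_excess ns" "set (l # ls) \<subseteq> L"
  shows "\<exists>k>0. F (caterpillar g ns (map g ls) (g l))
    = Poly_Mapping.single (pm_of_list (ns @ map (\<lambda>l. (l, 0)) (l # ls))) (of_nat k)"
proof -
  obtain k where k: "k > 0" "F (caterpillar g ns (map g ls) (g l))
      = of_nat k * prod_list (map zvar ns) * prod_list (map F (map g ls)) * F (g l)"
    using eval_caterpillar[of ns "map g ls" "g l"] assms by auto
  have e: "map F (map g ls) = map zvar (map (\<lambda>l. (l, 0)) ls)"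
    using assms(3) by (auto simp: F_g)
  then have "F (caterpillar g ns (map g ls) (g l))
      = of_nat k * prod_list (map zvar (ns @ map (\<lambda>l. (l, 0)) (l # ls)))"
    using assms(3) unfolding k(2) e by (simp add: F_g algebra_simps)
  also have "\<dots> = Poly_Mapping.single (pm_of_list (ns @ map (\<lambda>l. (l, 0)) (l # ls))) (of_nat k)"
    by (simp only: prod_list_zvar single_of_nat[symmetric] mult_single) simp
  finally show ?thesis using k(1) by blast
qed

lemma eval_inj_on_span_caterpillars:
  assumes F_scale: "\<And>c x. F (scale c x) = pm_smult c (F x)"
    and x: "x \<in> span (caterpillars g A L)" "F x = 0"
  shows "x = 0"
proof -
  let ?ok = "\<lambda>ns ls l. set ns \<subseteq> nodes A L \<and> length ls = total_excess ns \<and> set (l # ls) \<subseteq> L"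
  let ?\<beta> = "\<lambda>ns ls l. pm_of_list (ns @ map (\<lambda>l. (l, 0)) (l # ls))"
  \<comment> \<open>Monomial and coefficient are attached to the element itself, since it may be
    described by several choices of \<open>ns\<close>, \<open>ls\<close> and
    \<open>l\<close>.\<close>
  have "\<forall>x\<in>caterpillars g A L. \<exists>\<beta> r. F x = Poly_Mapping.single \<beta> r \<and> r \<noteq> 0 \<and>
      (\<exists>ns ls l. ?ok ns ls l \<and> x = caterpillar g ns (map g ls) (g l) \<and> \<beta> = ?\<beta> ns ls l)"
  proof
    fix x assume "x \<in> caterpillars g A L"
    then obtain ns ls l where ok: "?ok ns ls l" and x: "x = caterpillar g ns (map g ls) (g l)"
      by (auto simp: caterpillars_def)
    obtain k where "k > 0" "F x = Poly_Mapping.single (?\<beta> ns ls l) (of_nat k)"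
      using eval_caterpillar_gens[of ns ls l] ok unfolding x by blast
    then show "\<exists>\<beta> r. F x = Poly_Mapping.single \<beta> r \<and> r \<noteq> 0 \<and>
        (\<exists>ns ls l. ?ok ns ls l \<and> x = caterpillar g ns (map g ls) (g l) \<and> \<beta> = ?\<beta> ns ls l)"
      using ok x by (intro exI[of _ "?\<beta> ns ls l"] exI[of _ "of_nat k"]) auto
  qed
  then obtain b r where br: "\<And>x. x \<in> caterpillars g A L \<Longrightarrow> F x = Poly_Mapping.single (b x) (r x) \<and> r x \<noteq> 0 \<and>
      (\<exists>ns ls l. ?ok ns ls l \<and> x = caterpillar g ns (map g ls) (g l) \<and> b x = ?\<beta> ns ls l)"
    by metis
  have "inj_on b (caterpillars g A L)"
  proof (rule inj_onI)
    fix x y assume xy: "x \<in> caterpillars g A L" "y \<in> caterpillars g A L" and eq: "b x = b y"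
    obtain ns ls l where x: "?ok ns ls l" "x = caterpillar g ns (map g ls) (g l)" "b x = ?\<beta> ns ls l"
      using br[OF xy(1)] by blast
    obtain ns' ls' l' where y: "?ok ns' ls' l'" "y = caterpillar g ns' (map g ls') (g l')" "b y = ?\<beta> ns' ls' l'"
      using br[OF xy(2)] by blast
    have n0: "\<forall>n\<in>set ns. snd n \<noteq> 0" "\<forall>n\<in>set ns'. snd n \<noteq> 0"
      using x(1) y(1) by (auto simp: nodes_def)
    have ms: "mset (ns @ map (\<lambda>l. (l, 0)) (l # ls)) = mset (ns' @ map (\<lambda>l. (l, 0)) (l' # ls'))"
      using eq unfolding x(3) y(3) by (rule pm_of_list_eq_iff[THEN iffD1])
    \<comment> \<open>The condition \<open>w \<noteq> 0\<close> separates inner vertices from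
      leaves, so the monomial determines both multisets and the two permutation lemmas
      apply.\<close>
    have "filter (\<lambda>n. snd n \<noteq> 0) (ns @ map (\<lambda>l. (l, 0)) (l # ls)) = ns"
      "filter (\<lambda>n. snd n \<noteq> 0) (ns' @ map (\<lambda>l. (l, 0)) (l' # ls')) = ns'"
      using n0 by (auto simp: filter_id_conv filter_empty_conv)
    then have ns: "mset ns = mset ns'" using ms by (metis mset_filter)
    then have "mset (map (\<lambda>l. (l, 0 :: 'a \<Rightarrow>\<^sub>0 nat)) (l # ls)) = mset (map (\<lambda>l. (l, 0)) (l' # ls'))"
      using ms by simp
    then have "image_mset fst (mset (map (\<lambda>l. (l, 0 :: 'a \<Rightarrow>\<^sub>0 nat)) (l # ls)))
        = image_mset fst (mset (map (\<lambda>l. (l, 0 :: 'a \<Rightarrow>\<^sub>0 nat)) (l' # ls')))" by simp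
    then have "mset (l # ls) = mset (l' # ls')"
      by (simp only: mset_map[symmetric] map_map o_def fst_conv map_ident)
    then have ls: "mset (g l # map g ls) = mset (g l' # map g ls')"
      by (metis list.simps(9) mset_map)
    have "x = caterpillar g ns (map g ls') (g l')"
      unfolding x(2) by (rule caterpillar_permute_leaves) (use n0 x(1) ls in auto)
    also have "\<dots> = y"
      unfolding y(2)
    proof (rule caterpillar_permute_nodes)
      have "total_excess ns = total_excess ns'" using ns by (metis mset_map sum_mset_sum_list)
      then show "length (map g ls') = total_excess ns" using y(1) by simp
    qed (use n0 ns in auto)
    finally show "x = y" .
  qed
  then show ?thesis
    using inj_on_span_if_monomial[OF F_add F_scale, of "caterpillars g A L" b r x] br x by blast
qed

text \<open>The variables of a degree 1 monomial can be assembled into a caterpillar, and the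
  integer factor of its image is divided out.\<close>

lemma homogeneous_subset_range_eval:
  assumes F_scale: "\<And>c x. F (scale c x) = pm_smult c (F x)"
    and P: "P \<in> homogeneous A L 1"
  shows "P \<in> range F"
  using P unfolding homogeneous_def
proof (induction rule: lin_combs_induct)
  case zero
  have "F 0 = 0" using F_add[of 0 0] by simp
  then show ?case by (metis rangeI)
next
  case (add p q)
  then obtain x y where "p = F x" "q = F y" by blast
  then have "p + q = F (x + y)" by (simp add: F_add)
  then show ?case by blast
next
  case (single \<beta> c)
  define vs where "vs = list_of_pm \<beta>"
  define ns where "ns = filter (\<lambda>v. snd v \<noteq> 0) vs"
  define ls where "ls = map fst (filter (\<lambda>v. snd v = 0) vs)"
  have vs: "set vs \<subseteq> L \<times> fin_maps A" using single by (simp add: vs_def gen_multi_indices_def fin_maps_def)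
  have mp: "map (\<lambda>l. (l, 0)) ls = filter (\<lambda>v. snd v = 0) vs"
    unfolding ls_def by (induction vs) auto
  have "mset vs = mset (ns @ map (\<lambda>l. (l, 0)) ls)"
    unfolding mp ns_def using multiset_partition[of "mset vs" "\<lambda>v. snd v \<noteq> 0"] by simp
  then have \<beta>: "\<beta> = pm_of_list (ns @ map (\<lambda>l. (l, 0)) ls)"
    unfolding pm_of_list_eq_iff[symmetric] by (simp add: vs_def)
  have wns: "weight (pm_of_list ns) = - int (total_excess ns)" if "\<forall>n\<in>set ns. snd n \<noteq> 0" for ns :: "('a, 'l) zvar list"
    using that
  proof (induction ns)
    case (Cons n ns)
    then have "len (snd n) \<ge> 1" using len_eq_0_iff[of "snd n"] by (simp del: len_eq_0_iff)
    then show ?case using Cons by (simp add: weight_add excess_def)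
  qed simp
  have wls: "weight (pm_of_list (map (\<lambda>l. (l, 0)) ls)) = int (length ls)" for ls :: "'l list"
    by (induction ls) (simp_all add: weight_add)
  have "weight \<beta> = int (length ls) - int (total_excess ns)"
    unfolding \<beta> pm_of_list_simps weight_add by (subst wns) (auto simp: wls ns_def)
  \<comment> \<open>Degree 1 provides one leaf more than the total excess; the additional one ends
    the spine.\<close>
  then have len: "length ls = Suc (total_excess ns)" using single by simp
  then obtain l ks where ls: "ls = l # ks" by (cases ls) auto
  have "set ls \<subseteq> L" using vs by (auto simp: ls_def)
  moreover have "set ns \<subseteq> nodes A L" using vs by (auto simp: ns_def nodes_def)
  ultimately obtain k where k: "k > 0" "F (caterpillar g ns (map g ks) (g l)) = Poly_Mapping.single \<beta> (of_nat k)"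
    using eval_caterpillar_gens[of ns ks l] len unfolding ls \<beta> by auto
  have "F (scale (c / of_nat k) (caterpillar g ns (map g ks) (g l))) = Poly_Mapping.single \<beta> c"
    using k by (simp add: F_scale pm_smult_simps)
  then show ?case by (metis rangeI)
qed

end

end

end


section \<open>The free multi-Novikov algebra as a total algebra\<close>

text \<open>A linear projection with kernel \<open>nov_ideal A L\<close> on the combinations of terms turns the whole type
  into a multi-Novikov algebra (labels outside \<open>A\<close> act by zero), so that the quotient can be treated
  without cosets and carrier sets.\<close>

locale nov_ideal_projection =
  fixes A :: "'a set" and L :: "'l set"
    and \<pi> :: "(('a, 'l) nov_term \<Rightarrow>\<^sub>0 'k::field_char_0) \<Rightarrow> (('a, 'l) nov_term \<Rightarrow>\<^sub>0 'k)"
  assumes proj_linear: "Vector_Spaces.linear pm_smult pm_smult \<pi>"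
    and proj_closed: "\<pi> x \<in> lin_combs (nov_terms A L)"
    and proj_cong: "x \<in> lin_combs (nov_terms A L) \<Longrightarrow> \<pi> x - x \<in> nov_ideal A L"
    and proj_ideal: "x \<in> nov_ideal A L \<Longrightarrow> \<pi> x = 0"
begin

text \<open>The arguments are projected as well, so that the identities hold also for elements
  outside \<open>lin_combs (nov_terms A L)\<close>.\<close>

definition pnov :: "(('a, 'l) nov_term \<Rightarrow>\<^sub>0 'k) \<Rightarrow> 'a \<Rightarrow> (('a, 'l) nov_term \<Rightarrow>\<^sub>0 'k) \<Rightarrow> (('a, 'l) nov_term \<Rightarrow>\<^sub>0 'k)"
  where "pnov x a y = (if a \<in> A then \<pi> (magma_prod (\<pi> x) a (\<pi> y)) else 0)"

lemma proj_add: "\<pi> (x + y) = \<pi> x + \<pi> y"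
  and proj_smult: "\<pi> (pm_smult c x) = pm_smult c (\<pi> x)"
  using proj_linear by (simp_all add: Vector_Spaces.linear_iff)

lemma proj_zero [simp]: "\<pi> 0 = 0"
  by (simp add: proj_ideal nov_ideal.zero)

lemma proj_diff: "\<pi> (x - y) = \<pi> x - \<pi> y"
  using proj_add[of "x - y" y] by (simp add: algebra_simps)

lemma proj_eqI: "x - y \<in> nov_ideal A L \<Longrightarrow> \<pi> x = \<pi> y"
  using proj_ideal[of "x - y"] by (simp add: proj_diff)

lemma proj_magma_prod_left:
  assumes "a \<in> A" "x \<in> lin_combs (nov_terms A L)" "y \<in> lin_combs (nov_terms A L)"
  shows "\<pi> (magma_prod (\<pi> x) a y) = \<pi> (magma_prod x a y)"
  using nov_ideal.prod_right[OF assms(1) proj_cong[OF assms(2)] assms(3)]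
  by (intro proj_eqI) (simp add: magma_prod_diff)

lemma proj_magma_prod_right:
  assumes "a \<in> A" "x \<in> lin_combs (nov_terms A L)" "y \<in> lin_combs (nov_terms A L)"
  shows "\<pi> (magma_prod x a (\<pi> y)) = \<pi> (magma_prod x a y)"
  using nov_ideal.prod_left[OF assms(1) proj_cong[OF assms(3)] assms(2)]
  by (intro proj_eqI) (simp add: magma_prod_diff)

lemma proj_magma_prod:
  assumes "a \<in> A" "x \<in> lin_combs (nov_terms A L)" "y \<in> lin_combs (nov_terms A L)"
  shows "\<pi> (magma_prod x a y) = pnov x a y"
  using assms by (simp add: pnov_def proj_magma_prod_left proj_magma_prod_right proj_closed)

lemma pnov_pnov_left:
  "a \<in> A \<Longrightarrow> b \<in> A \<Longrightarrow> pnov (pnov x a y) b z = \<pi> (magma_prod (magma_prod (\<pi> x) a (\<pi> y)) b (\<pi> z))"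
  by (simp add: pnov_def proj_magma_prod_left proj_closed magma_prod_closed)

lemma pnov_pnov_right:
  "a \<in> A \<Longrightarrow> b \<in> A \<Longrightarrow> pnov x a (pnov y b z) = \<pi> (magma_prod (\<pi> x) a (magma_prod (\<pi> y) b (\<pi> z)))"
  by (simp add: pnov_def proj_magma_prod_right proj_closed magma_prod_closed)

text \<open>For labels in \<open>A\<close> the identities are the generators of the ideal, killed by
  \<open>\<pi>\<close>; as soon as one label lies outside \<open>A\<close>, every term is 0.\<close>

lemma total_multi_novikov_pnov: "total_multi_novikov pm_smult pnov"
proof (intro total_multi_novikov.intro vector_space_pm_smult total_multi_novikov_axioms.intro)
  fix x y z :: "('a, 'l) nov_term \<Rightarrow>\<^sub>0 'k" and a b
  have out: "a \<notin> A \<Longrightarrow> pnov x a y = 0" "pnov 0 a y = 0" "pnov x a 0 = 0" for x a y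
    by (simp_all add: pnov_def magma_prod_def)
  show "pnov (pnov x a y) b z - pnov x a (pnov y b z) = pnov (pnov y a x) b z - pnov y a (pnov x b z)"
  proof (cases "a \<in> A \<and> b \<in> A")
    case True
    with proj_ideal[OF nov_ideal.rel1[of a A b "\<pi> x" L "\<pi> y" "\<pi> z"]] show ?thesis
      by (simp add: pnov_pnov_left pnov_pnov_right proj_diff proj_closed)
  qed (auto simp: out)
  show "pnov (pnov x a y) b z - pnov x a (pnov y b z) = pnov (pnov x b y) a z - pnov x b (pnov y a z)"
  proof (cases "a \<in> A \<and> b \<in> A")
    case True
    with proj_ideal[OF nov_ideal.rel2[of a A b "\<pi> x" L "\<pi> y" "\<pi> z"]] show ?thesis
      by (simp add: pnov_pnov_left pnov_pnov_right proj_diff proj_closed)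
  qed (auto simp: out)
  show "pnov (pnov x a y) b z = pnov (pnov x b z) a y"
  proof (cases "a \<in> A \<and> b \<in> A")
    case True
    with proj_ideal[OF nov_ideal.rel3[of a A b "\<pi> x" L "\<pi> y" "\<pi> z"]] show ?thesis
      by (simp add: pnov_pnov_left proj_diff proj_closed)
  qed (auto simp: out)
qed (simp_all add: pnov_def proj_add proj_smult magma_prod_add_left magma_prod_add_right
    magma_prod_smult_left magma_prod_smult_right pm_smult_simps)

sublocale pnov: total_multi_novikov pm_smult pnov
  by (rule total_multi_novikov_pnov)

definition pgen :: "'l \<Rightarrow> (('a, 'l) nov_term \<Rightarrow>\<^sub>0 'k)" where
  "pgen l = \<pi> (Poly_Mapping.single (Gen l) 1)"

text \<open>Induction over terms: the span contains the projected generators and is closed under the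
  products.\<close>

lemma proj_in_span_caterpillars:
  "x \<in> lin_combs (nov_terms A L) \<Longrightarrow> \<pi> x \<in> pnov.span (pnov.caterpillars pgen A L)"
proof (induction rule: lin_combs_induct)
  case zero
  then show ?case by (simp add: pnov.span_zero)
next
  case (add p q)
  then show ?case by (simp add: proj_add pnov.span_add)
next
  case (single t c)
  have "\<pi> (Poly_Mapping.single t 1) \<in> pnov.span (pnov.caterpillars pgen A L)"
    using single
  proof (induction t)
    case (Gen l)
    then show ?case using pnov.gen_in_span[of l L pgen A] by (simp add: nov_terms_def flip: pgen_def)
  next
    case (Prod s a t)
    then have st: "s \<in> nov_terms A L" "t \<in> nov_terms A L" "a \<in> A" by (auto simp: nov_terms_def)
    have "\<pi> (Poly_Mapping.single (Prod s a t) 1)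
        = \<pi> (magma_prod (Poly_Mapping.single s 1) a (Poly_Mapping.single t 1))"
      by (simp add: magma_prod_single)
    also have "\<dots> = \<pi> (magma_prod (\<pi> (Poly_Mapping.single s 1)) a (\<pi> (Poly_Mapping.single t 1)))"
      using st by (simp add: proj_magma_prod_left proj_magma_prod_right proj_closed lin_combs_single)
    also have "\<dots> = pnov (\<pi> (Poly_Mapping.single s 1)) a (\<pi> (Poly_Mapping.single t 1))"
      using st by (intro proj_magma_prod proj_closed)
    also have "\<dots> \<in> pnov.span (pnov.caterpillars pgen A L)"
      using Prod.IH st by (intro pnov.nov_in_span)
    finally show ?case .
  qed
  then have "pm_smult c (\<pi> (Poly_Mapping.single t 1)) \<in> pnov.span (pnov.caterpillars pgen A L)"
    by (rule pnov.span_scale)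
  then show ?case by (simp add: proj_smult[symmetric] pm_smult_simps)
qed

end

lemma ex_nov_ideal_projection:
  "\<exists>\<pi>. nov_ideal_projection A L (\<pi> :: (('a, 'l) nov_term \<Rightarrow>\<^sub>0 'k::field_char_0) \<Rightarrow> _)"
proof -
  interpret vector_space "pm_smult :: 'k \<Rightarrow> (('a, 'l) nov_term \<Rightarrow>\<^sub>0 'k) \<Rightarrow> _"
    by (rule vector_space_pm_smult)
  have "subspace (nov_ideal A L)"
    by (auto simp: subspace_def intro: nov_ideal.zero nov_ideal.add nov_ideal.smult)
  moreover have "subspace (lin_combs (nov_terms A L))"
    by (auto simp: subspace_def lin_combs_add lin_combs_smult)
  moreover have "nov_ideal A L \<subseteq> lin_combs (nov_terms A L)" using nov_ideal_subset by blast
  ultimately obtain \<pi> :: "(('a, 'l) nov_term \<Rightarrow>\<^sub>0 'k) \<Rightarrow> (('a, 'l) nov_term \<Rightarrow>\<^sub>0 'k)"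
    where "Vector_Spaces.linear pm_smult pm_smult \<pi>" "range \<pi> \<subseteq> lin_combs (nov_terms A L)"
      "\<forall>x\<in>lin_combs (nov_terms A L). \<pi> x - x \<in> nov_ideal A L" "\<forall>x\<in>nov_ideal A L. \<pi> x = 0"
    by (rule ex_projection_mod_subspace[THEN exE]) blast
  then have "nov_ideal_projection A L \<pi>"
    by (intro nov_ideal_projection.intro) auto
  then show ?thesis by blast
qed

text \<open>The universal property yields a morphism out of the free algebra, whereas the
  isomorphism is asked for in the opposite direction.\<close>

lemma nov_hom_inv_into:
  fixes N :: "('k::field_char_0, 'a, 'v, 'm) nov_algebra_scheme"
  assumes N: "multi_novikov_algebra A N" and h: "h \<in> nov_hom A N N'"
    and bij: "bij_betw h (carrier N) (carrier N')"
  shows "inv_into (carrier N) h \<in> nov_hom A N' N"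
proof -
  interpret multi_novikov_algebra A N by fact
  let ?g = "inv_into (carrier N) h"
  have g: "?g x \<in> carrier N" "h (?g x) = x" if "x \<in> carrier N'" for x
    using that bij by (auto simp: bij_betw_def inv_into_into f_inv_into_f)
  have eq: "?g (h x) = x" if "x \<in> carrier N" for x
    using that bij by (simp add: bij_betw_def)
  have "?g (x \<oplus>\<^bsub>N'\<^esub> y) = ?g x \<oplus>\<^bsub>N\<^esub> ?g y" if "x \<in> carrier N'" "y \<in> carrier N'" for x y
    using that h g eq[of "?g x \<oplus>\<^bsub>N\<^esub> ?g y"] by (simp add: nov_hom_def)
  moreover have "?g (c \<odot>\<^bsub>N'\<^esub> x) = c \<odot>\<^bsub>N\<^esub> ?g x" if "x \<in> carrier N'" for c x
    using that h g eq[of "c \<odot>\<^bsub>N\<^esub> ?g x"] by (simp add: nov_hom_def)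
  moreover have "?g (x \<triangleright>[a]\<^bsub>N'\<^esub> y) = ?g x \<triangleright>[a]\<^bsub>N\<^esub> ?g y"
    if "a \<in> A" "x \<in> carrier N'" "y \<in> carrier N'" for a x y
    using that h g eq[of "?g x \<triangleright>[a]\<^bsub>N\<^esub> ?g y"] nprod_closed by (simp add: nov_hom_def)
  ultimately show ?thesis using g by (auto simp: nov_hom_def)
qed

theorem theorem1p2:
  fixes d :: nat and L :: "'l set"
  assumes "finite L"
  shows "nov_isomorphic (Nd d)
    (M_gen d L :: ('k::field_char_0, nat \<Rightarrow> nat, (nat \<Rightarrow> nat, 'l, 'k) zpoly) nov_algebra)
    (free_multi_novikov (Nd d) L)"
proof -
  let ?A = "Nd d"
  let ?M = "M_gen d L :: ('k, nat \<Rightarrow> nat, (nat \<Rightarrow> nat, 'l, 'k) zpoly) nov_algebra"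
  let ?N = "free_multi_novikov ?A L :: ('k, nat \<Rightarrow> nat, ((nat \<Rightarrow> nat, 'l) nov_term \<Rightarrow>\<^sub>0 'k) set) nov_algebra"
  let ?W = "lin_combs (nov_terms ?A L) :: ((nat \<Rightarrow> nat, 'l) nov_term \<Rightarrow>\<^sub>0 'k) set"
  \<comment> \<open>The variable \<open>(l, 0)\<close> has degree 1 and is thus the natural image of
    the generator \<open>l\<close>.\<close>
  have "(\<lambda>l. zvar (l, 0)) \<in> L \<rightarrow> carrier ?M"
    using homogeneous_zvar[of "(l, 0)" L ?A for l] by (auto simp: M_gen_simps fin_maps_def)
  from free_multi_novikov_universal[OF M_gen_multi_novikov this]
  obtain h where h: "h \<in> nov_hom ?A ?N ?M" and h_gen: "\<And>l. l \<in> L \<Longrightarrow> h (free_gen ?A L l) = zvar (l, 0)"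
    by blast
  define H where "H x = h (nov_coset ?A L x)" for x
  have H_add: "H (x + y) = H x + H y" if "x \<in> ?W" "y \<in> ?W" for x y
    using h that by (auto simp: H_def nov_hom_def free_carrier M_gen_simps free_add[symmetric])
  have H_smult: "H (pm_smult c x) = pm_smult c (H x)" if "x \<in> ?W" for c x
    using h that by (auto simp: H_def nov_hom_def free_carrier M_gen_simps free_smult[symmetric])
  have H_nprod: "H (magma_prod x a y) = H x * zD a (H y)" if "a \<in> ?A" "x \<in> ?W" "y \<in> ?W" for a x y
    using h that by (auto simp: H_def nov_hom_def free_carrier M_gen_simps free_nprod[symmetric])
  obtain \<pi> :: "((nat \<Rightarrow> nat, 'l) nov_term \<Rightarrow>\<^sub>0 'k) \<Rightarrow> _" where "nov_ideal_projection ?A L \<pi>"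
    using ex_nov_ideal_projection by blast
  then interpret nov_ideal_projection ?A L \<pi> .
  have H_proj: "H (\<pi> x) = H x" if "x \<in> ?W" for x
    by (simp only: H_def nov_coset_eq_iff[THEN iffD2, OF proj_cong[OF that]])
  \<comment> \<open>\<open>H\<close> is known to be additive on \<open>?W\<close> only;
    precomposition with \<open>\<pi>\<close> extends this to the whole type, as the evaluation
    lemmas require.\<close>
  define F where "F x = H (\<pi> x)" for x
  have F_add: "F (x + y) = F x + F y" for x y
    by (simp add: F_def proj_add H_add proj_closed)
  have F_smult: "F (pm_smult c x) = pm_smult c (F x)" for c x
    by (simp add: F_def proj_smult H_smult proj_closed)
  have F_nov: "F (pnov x a y) = F x * zD a (F y)" if "a \<in> ?A" for x a y
    using that by (simp add: F_def pnov_def H_proj H_nprod proj_closed magma_prod_closed)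
  have F_gen: "F (pgen l) = zvar (l, 0)" if "l \<in> L" for l
  proof -
    have "Gen l \<in> nov_terms ?A L" using that by (simp add: nov_terms_def)
    then have "F (pgen l) = H (Poly_Mapping.single (Gen l) 1)"
      by (simp add: F_def pgen_def H_proj proj_closed lin_combs_single)
    also have "\<dots> = zvar (l, 0)"
      using h_gen[OF that] by (simp add: H_def nov_coset_def free_gen_def)
    finally show ?thesis .
  qed
  have inj: "inj_on h (carrier ?N)"
  proof (rule inj_onI)
    fix U V assume "U \<in> carrier ?N" "V \<in> carrier ?N" and eq: "h U = h V"
    then obtain x y where xy: "x \<in> ?W" "U = nov_coset ?A L x" "y \<in> ?W" "V = nov_coset ?A L y"
      by (auto simp: free_carrier)
    have W: "x - y \<in> ?W" using xy by (intro lin_combs_diff)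
    have "H (x - y) + H y = H x" using H_add[OF W xy(3)] by simp
    then have "H (x - y) = 0" using eq by (simp add: xy H_def)
    then have F0: "F (\<pi> (x - y)) = 0" using W by (simp add: F_def H_proj proj_closed)
    \<comment> \<open>\<open>\<pi> (x - y)\<close> lies in the span of the caterpillars, where
      \<open>F\<close> is injective. By \<open>proj_cong\<close> its vanishing puts
      \<open>x - y\<close> into the ideal.\<close>
    have "\<pi> (x - y) = 0"
      by (rule pnov.eval_inj_on_span_caterpillars[where F = F and A = ?A and g = pgen and L = L])
        (simp_all only: F_add F_nov F_gen F_smult F0 proj_in_span_caterpillars[OF W])
    then have "- (x - y) \<in> nov_ideal ?A L" using proj_cong[OF W] by simp
    then have "x - y \<in> nov_ideal ?A L" using nov_ideal_uminus by fastforce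
    then show "U = V" by (simp add: xy nov_coset_eq_iff)
  qed
  have "P \<in> h ` carrier ?N" if "P \<in> carrier ?M" for P
  proof -
    have "P \<in> range F"
      by (rule pnov.homogeneous_subset_range_eval[where F = F and A = ?A and g = pgen and L = L])
        (use that in \<open>simp_all add: F_add F_nov F_gen F_smult M_gen_simps\<close>)
    then show ?thesis using proj_closed by (auto simp: F_def H_def free_carrier)
  qed
  moreover have "h \<in> carrier ?N \<rightarrow> carrier ?M" using h by (simp add: nov_hom_def)
  ultimately have bij: "bij_betw h (carrier ?N) (carrier ?M)"
    using inj by (auto simp: bij_betw_def)
  show ?thesis
    unfolding nov_isomorphic_def
    using nov_hom_inv_into[OF free_multi_novikov_algebra h bij] bij_betw_inv_into[OF bij]
      M_gen_multi_novikov free_multi_novikov_algebra by blast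
qed

end
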